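(* Let $\mathcal{B}$ be an additive category, let $(1)\colon \mathcal{B}\to\mathcal{B}$ be an automorphism, and let $\eta\colon (1)\to \mathrm{Id}_{\mathcal{B}}$ be a natural transformation such that $\eta_{X(1)}=\eta_X(1)$ for every object $X$ of $\mathcal{B}$. Let $C(\mathcal{B})$ be the category of complexes in $\mathcal{B}$ and let $\mathcal{E}_\eta$ be the class of $\eta$-conflations. Then the exact category $(C(\mathcal{B}),\mathcal{E}_\eta)$ is a Frobenius category.
   Context: All functors are additive. $C(\mathcal{B})$ is the category of (unbounded, cohomologically graded) complexes in $\mathcal{B}$. The shift is $(X^\bullet[1])^n=X^{n+1}$, $d_{X[1]}^n=-d_X^{n+1}$. For a chain map $f^\bullet\colon X^\bullet\to Y^\bullet$ the mapping cone $\mathrm{Con}(f^\bullet)$ has terms $X^{n+1}\oplus Y^n$ and differential $\begin{pmatrix}-d_X^{n+1}&0\\ f^{n+1}&d_Y^n\end{pmatrix}$. Applying $(1)$ and $\eta$ termwise gives an automorphism of $C(\mathcal{B})$ and a natural transformation $\eta\colon(1)\to\mathrm{Id}_{C(\mathcal{B})}$, denoted by the same symbols. If a chain map $f^\bullet\colon X^\bullet\to Y^\bullet$ factors through $\eta_{Y^\bullet}\colon Y^\bullet(1)\to Y^\bullet$ in $C(\mathcal{B})$, then the sequence $Y^\bullet\xrightarrow{\binom{0}{1}}\mathrm{Con}(f^\bullet)\xrightarrow{(1\ 0)}X^\bullet[1]$ is called a standard $\eta$-conflation. $\mathcal{E}_\eta$ is the class of all exact pairs (kernel-cokernel pairs)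 in $C(\mathcal{B})$ isomorphic to some standard $\eta$-conflation; its elements $(i^\bullet,p^\bullet)$ are called $\eta$-conflations ($i^\bullet$ is an $\eta$-inflation, $p^\bullet$ an $\eta$-deflation). Exact category is meant in the sense of Quillen/Keller: an additive category with a class of kernel-cokernel pairs (conflations), closed under isomorphism, such that the identity of $0$ is a deflation, deflations and inflations are closed under composition, pullbacks of deflations along arbitrary morphisms exist and are deflations, and pushouts of inflations along arbitrary morphisms exist and are inflations. Projective and injective objects are relative to deflations and inflations. An exact category is Frobenius if it has enough projectives and enough injectives and the projective objects coincide with the injective objects. *)

theory Defs
  imports "HOL-Algebra.Group"
begin

section \<open>Additive categories\<close>

text \<open>
  Composition is in applicative order: \<open>g \<cdot> f\<close> is ``first \<open>f\<close>, then \<open>g\<close>''.  Every arrow determines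
  its domain and codomain.  All axioms are relative to \<open>Obj\<close> and \<open>Arr\<close>; values outside are junk.
\<close>

record ('o, 'm) cat =
  Obj :: "'o set"
  Arr :: "'m set"
  Dom :: "'m \<Rightarrow> 'o"
  Cod :: "'m \<Rightarrow> 'o"
  ident :: "'o \<Rightarrow> 'm"
  Comp :: "'m \<Rightarrow> 'm \<Rightarrow> 'm"  (infixl "\<cdot>\<index>" 75)
  Add :: "'m \<Rightarrow> 'm \<Rightarrow> 'm"  (infixl "\<boxplus>\<index>" 65)
  Zero :: "'o \<Rightarrow> 'o \<Rightarrow> 'm"

definition Hom :: "('o, 'm) cat \<Rightarrow> 'o \<Rightarrow> 'o \<Rightarrow> 'm set" where
  "Hom C A B = {f \<in> Arr C. Dom C f = A \<and> Cod C f = B}"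

definition Hom_group :: "('o, 'm) cat \<Rightarrow> 'o \<Rightarrow> 'o \<Rightarrow> 'm monoid" where
  "Hom_group C A B = \<lparr>carrier = Hom C A B, monoid.mult = Add C, one = Zero C A B\<rparr>"

definition Neg :: "('o, 'm) cat \<Rightarrow> 'm \<Rightarrow> 'm" where
  "Neg C f = inv\<^bsub>Hom_group C (Dom C f) (Cod C f)\<^esub> f"

locale category =
  fixes C :: "('o, 'm) cat" (structure)
  assumes dom_obj: "f \<in> Arr C \<Longrightarrow> Dom C f \<in> Obj C"
    and cod_obj: "f \<in> Arr C \<Longrightarrow> Cod C f \<in> Obj C"
    and ident_hom: "A \<in> Obj C \<Longrightarrow> ident C A \<in> Hom C A A"
    and comp_hom: "\<lbrakk>f \<in> Hom C A B; g \<in> Hom C B D\<rbrakk> \<Longrightarrow> g \<cdot> f \<in> Hom C A D"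
    and comp_ident_right: "f \<in> Hom C A B \<Longrightarrow> f \<cdot> ident C A = f"
    and comp_ident_left: "f \<in> Hom C A B \<Longrightarrow> ident C B \<cdot> f = f"
    and comp_assoc: "\<lbrakk>f \<in> Hom C A B; g \<in> Hom C B D; h \<in> Hom C D E\<rbrakk>
      \<Longrightarrow> (h \<cdot> g) \<cdot> f = h \<cdot> (g \<cdot> f)"

locale preadditive_category = category +
  assumes hom_comm_group: "\<lbrakk>A \<in> Obj C; B \<in> Obj C\<rbrakk> \<Longrightarrow> comm_group (Hom_group C A B)"
    and comp_add_left: "\<lbrakk>f \<in> Hom C A B; g \<in> Hom C B D; h \<in> Hom C B D\<rbrakk>
      \<Longrightarrow> (g \<boxplus> h) \<cdot> f = (g \<cdot> f) \<boxplus> (h \<cdot> f)"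
    and comp_add_right: "\<lbrakk>f \<in> Hom C A B; g \<in> Hom C A B; h \<in> Hom C B D\<rbrakk>
      \<Longrightarrow> h \<cdot> (f \<boxplus> g) = (h \<cdot> f) \<boxplus> (h \<cdot> g)"

definition zero_object :: "('o, 'm) cat \<Rightarrow> 'o \<Rightarrow> bool" where
  "zero_object C Z \<longleftrightarrow> Z \<in> Obj C \<and>
     (\<forall>A\<in>Obj C. (\<exists>!f. f \<in> Hom C A Z) \<and> (\<exists>!f. f \<in> Hom C Z A))"

record ('o, 'm) biproduct =
  bp_obj :: 'o
  bp_in1 :: 'm
  bp_in2 :: 'm
  bp_pr1 :: 'm
  bp_pr2 :: 'm

definition is_biproduct :: "('o, 'm) cat \<Rightarrow> 'o \<Rightarrow> 'o \<Rightarrow> ('o, 'm) biproduct \<Rightarrow> bool" where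
  "is_biproduct C A B S \<longleftrightarrow>
     bp_obj S \<in> Obj C \<and>
     bp_in1 S \<in> Hom C A (bp_obj S) \<and> bp_in2 S \<in> Hom C B (bp_obj S) \<and>
     bp_pr1 S \<in> Hom C (bp_obj S) A \<and> bp_pr2 S \<in> Hom C (bp_obj S) B \<and>
     bp_pr1 S \<cdot>\<^bsub>C\<^esub> bp_in1 S = ident C A \<and> bp_pr2 S \<cdot>\<^bsub>C\<^esub> bp_in2 S = ident C B \<and>
     bp_pr2 S \<cdot>\<^bsub>C\<^esub> bp_in1 S = Zero C A B \<and> bp_pr1 S \<cdot>\<^bsub>C\<^esub> bp_in2 S = Zero C B A \<and>
     (bp_in1 S \<cdot>\<^bsub>C\<^esub> bp_pr1 S) \<boxplus>\<^bsub>C\<^esub> (bp_in2 S \<cdot>\<^bsub>C\<^esub> bp_pr2 S) = ident C (bp_obj S)"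

locale additive_category = preadditive_category +
  assumes zero_object_exists: "\<exists>Z. zero_object C Z"
    and biproduct_exists: "\<lbrakk>A \<in> Obj C; B \<in> Obj C\<rbrakk> \<Longrightarrow> \<exists>S. is_biproduct C A B S"

text \<open>A fixed choice of the direct sum \<open>A \<oplus> B\<close>; direct sums are unique up to isomorphism.\<close>

definition dsum :: "('o, 'm) cat \<Rightarrow> 'o \<Rightarrow> 'o \<Rightarrow> ('o, 'm) biproduct" where
  "dsum C A B = (SOME S. is_biproduct C A B S)"

text \<open>The morphism \<open>A \<oplus> A' \<rightarrow> B \<oplus> B'\<close> with matrix rows \<open>(a b)\<close> and \<open>(c d)\<close>.\<close>

definition matrix :: "('o, 'm) cat \<Rightarrow> ('o, 'm) biproduct \<Rightarrow> ('o, 'm) biproduct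
    \<Rightarrow> 'm \<Rightarrow> 'm \<Rightarrow> 'm \<Rightarrow> 'm \<Rightarrow> 'm" where
  "matrix C S T a b c d =
     (bp_in1 T \<cdot>\<^bsub>C\<^esub> ((a \<cdot>\<^bsub>C\<^esub> bp_pr1 S) \<boxplus>\<^bsub>C\<^esub> (b \<cdot>\<^bsub>C\<^esub> bp_pr2 S)))
     \<boxplus>\<^bsub>C\<^esub> (bp_in2 T \<cdot>\<^bsub>C\<^esub> ((c \<cdot>\<^bsub>C\<^esub> bp_pr1 S) \<boxplus>\<^bsub>C\<^esub> (d \<cdot>\<^bsub>C\<^esub> bp_pr2 S)))"


section \<open>Functors and natural transformations\<close>

record ('o, 'm, 'p, 'n) fctr =
  on_obj :: "'o \<Rightarrow> 'p"
  on_arr :: "'m \<Rightarrow> 'n"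

definition id_fctr :: "('o, 'm, 'o, 'm) fctr" where
  "id_fctr = \<lparr>on_obj = (\<lambda>X. X), on_arr = (\<lambda>f. f)\<rparr>"

definition is_functor :: "('o, 'm) cat \<Rightarrow> ('p, 'n) cat \<Rightarrow> ('o, 'm, 'p, 'n) fctr \<Rightarrow> bool" where
  "is_functor C D F \<longleftrightarrow>
     (\<forall>A\<in>Obj C. on_obj F A \<in> Obj D) \<and>
     (\<forall>A\<in>Obj C. \<forall>B\<in>Obj C. \<forall>f\<in>Hom C A B. on_arr F f \<in> Hom D (on_obj F A) (on_obj F B)) \<and>
     (\<forall>A\<in>Obj C. on_arr F (ident C A) = ident D (on_obj F A)) \<and>
     (\<forall>f\<in>Arr C. \<forall>g\<in>Arr C. Dom C g = Cod C f \<longrightarrow>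
        on_arr F (g \<cdot>\<^bsub>C\<^esub> f) = on_arr F g \<cdot>\<^bsub>D\<^esub> on_arr F f)"

definition additive_functor :: "('o, 'm) cat \<Rightarrow> ('p, 'n) cat \<Rightarrow> ('o, 'm, 'p, 'n) fctr \<Rightarrow> bool" where
  "additive_functor C D F \<longleftrightarrow> is_functor C D F \<and>
     (\<forall>A\<in>Obj C. \<forall>B\<in>Obj C. \<forall>f\<in>Hom C A B. \<forall>g\<in>Hom C A B.
        on_arr F (f \<boxplus>\<^bsub>C\<^esub> g) = on_arr F f \<boxplus>\<^bsub>D\<^esub> on_arr F g)"

text \<open>An automorphism is strictly invertible, not merely an autoequivalence.\<close>

definition category_automorphism :: "('o, 'm) cat \<Rightarrow> ('o, 'm, 'o, 'm) fctr \<Rightarrow> bool" where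
  "category_automorphism C F \<longleftrightarrow> is_functor C C F \<and>
     (\<exists>G. is_functor C C G \<and>
        (\<forall>A\<in>Obj C. on_obj G (on_obj F A) = A \<and> on_obj F (on_obj G A) = A) \<and>
        (\<forall>f\<in>Arr C. on_arr G (on_arr F f) = f \<and> on_arr F (on_arr G f) = f))"

definition natural_transformation :: "('o, 'm) cat \<Rightarrow> ('p, 'n) cat \<Rightarrow> ('o, 'm, 'p, 'n) fctr
    \<Rightarrow> ('o, 'm, 'p, 'n) fctr \<Rightarrow> ('o \<Rightarrow> 'n) \<Rightarrow> bool" where
  "natural_transformation C D F G \<eta> \<longleftrightarrow>
     (\<forall>A\<in>Obj C. \<eta> A \<in> Hom D (on_obj F A) (on_obj G A)) \<and>
     (\<forall>A\<in>Obj C. \<forall>B\<in>Obj C. \<forall>f\<in>Hom C A B. \<eta> B \<cdot>\<^bsub>D\<^esub> on_arr F f = on_arr G f \<cdot>\<^bsub>D\<^esub> \<eta> A)"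


section \<open>Exact categories and Frobenius categories\<close>

definition is_kernel :: "('o, 'm) cat \<Rightarrow> 'm \<Rightarrow> 'm \<Rightarrow> bool" where
  "is_kernel C i p \<longleftrightarrow> i \<in> Arr C \<and> p \<in> Arr C \<and> Cod C i = Dom C p \<and>
     p \<cdot>\<^bsub>C\<^esub> i = Zero C (Dom C i) (Cod C p) \<and>
     (\<forall>f\<in>Arr C. Cod C f = Dom C p \<and> p \<cdot>\<^bsub>C\<^esub> f = Zero C (Dom C f) (Cod C p) \<longrightarrow>
        (\<exists>!u. u \<in> Hom C (Dom C f) (Dom C i) \<and> i \<cdot>\<^bsub>C\<^esub> u = f))"

definition is_cokernel :: "('o, 'm) cat \<Rightarrow> 'm \<Rightarrow> 'm \<Rightarrow> bool" where
  "is_cokernel C p i \<longleftrightarrow> i \<in> Arr C \<and> p \<in> Arr C \<and> Cod C i = Dom C p \<and>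
     p \<cdot>\<^bsub>C\<^esub> i = Zero C (Dom C i) (Cod C p) \<and>
     (\<forall>f\<in>Arr C. Dom C f = Cod C i \<and> f \<cdot>\<^bsub>C\<^esub> i = Zero C (Dom C i) (Cod C f) \<longrightarrow>
        (\<exists>!u. u \<in> Hom C (Cod C p) (Cod C f) \<and> u \<cdot>\<^bsub>C\<^esub> p = f))"

definition exact_pair :: "('o, 'm) cat \<Rightarrow> 'm \<Rightarrow> 'm \<Rightarrow> bool" where
  "exact_pair C i p \<longleftrightarrow> is_kernel C i p \<and> is_cokernel C p i"

definition iso_arr :: "('o, 'm) cat \<Rightarrow> 'm \<Rightarrow> bool" where
  "iso_arr C f \<longleftrightarrow> f \<in> Arr C \<and>
     (\<exists>g\<in>Hom C (Cod C f) (Dom C f).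
        g \<cdot>\<^bsub>C\<^esub> f = ident C (Dom C f) \<and> f \<cdot>\<^bsub>C\<^esub> g = ident C (Cod C f))"

definition pair_iso :: "('o, 'm) cat \<Rightarrow> 'm \<times> 'm \<Rightarrow> 'm \<times> 'm \<Rightarrow> bool" where
  "pair_iso C = (\<lambda>(i, p) (i', p').
     \<exists>a\<in>Hom C (Dom C i) (Dom C i'). \<exists>b\<in>Hom C (Cod C i) (Cod C i'). \<exists>c\<in>Hom C (Cod C p) (Cod C p').
       iso_arr C a \<and> iso_arr C b \<and> iso_arr C c \<and>
       b \<cdot>\<^bsub>C\<^esub> i = i' \<cdot>\<^bsub>C\<^esub> a \<and> c \<cdot>\<^bsub>C\<^esub> p = p' \<cdot>\<^bsub>C\<^esub> b)"

text \<open>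
  \<open>is_pullback C p f q g\<close>: the square \<open>p \<cdot> g = f \<cdot> q\<close> is cartesian, so \<open>q\<close> is the pullback of \<open>p\<close>
  along \<open>f\<close>.  Dually, \<open>is_pushout C i f j g\<close>: the square \<open>g \<cdot> i = j \<cdot> f\<close> is cocartesian, so \<open>j\<close> is
  the pushout of \<open>i\<close> along \<open>f\<close>.
\<close>

definition is_pullback :: "('o, 'm) cat \<Rightarrow> 'm \<Rightarrow> 'm \<Rightarrow> 'm \<Rightarrow> 'm \<Rightarrow> bool" where
  "is_pullback C p f q g \<longleftrightarrow>
     p \<in> Arr C \<and> f \<in> Arr C \<and> q \<in> Arr C \<and> g \<in> Arr C \<and>
     Cod C p = Cod C f \<and> Dom C q = Dom C g \<and> Cod C q = Dom C f \<and> Cod C g = Dom C p \<and>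
     p \<cdot>\<^bsub>C\<^esub> g = f \<cdot>\<^bsub>C\<^esub> q \<and>
     (\<forall>W\<in>Obj C. \<forall>x\<in>Hom C W (Dom C p). \<forall>y\<in>Hom C W (Dom C f). p \<cdot>\<^bsub>C\<^esub> x = f \<cdot>\<^bsub>C\<^esub> y \<longrightarrow>
        (\<exists>!u. u \<in> Hom C W (Dom C q) \<and> g \<cdot>\<^bsub>C\<^esub> u = x \<and> q \<cdot>\<^bsub>C\<^esub> u = y))"

definition is_pushout :: "('o, 'm) cat \<Rightarrow> 'm \<Rightarrow> 'm \<Rightarrow> 'm \<Rightarrow> 'm \<Rightarrow> bool" where
  "is_pushout C i f j g \<longleftrightarrow>
     i \<in> Arr C \<and> f \<in> Arr C \<and> j \<in> Arr C \<and> g \<in> Arr C \<and>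
     Dom C i = Dom C f \<and> Cod C j = Cod C g \<and> Dom C j = Cod C f \<and> Dom C g = Cod C i \<and>
     g \<cdot>\<^bsub>C\<^esub> i = j \<cdot>\<^bsub>C\<^esub> f \<and>
     (\<forall>W\<in>Obj C. \<forall>x\<in>Hom C (Cod C i) W. \<forall>y\<in>Hom C (Cod C f) W. x \<cdot>\<^bsub>C\<^esub> i = y \<cdot>\<^bsub>C\<^esub> f \<longrightarrow>
        (\<exists>!u. u \<in> Hom C (Cod C j) W \<and> u \<cdot>\<^bsub>C\<^esub> g = x \<and> u \<cdot>\<^bsub>C\<^esub> j = y))"

definition inflation :: "('m \<times> 'm) set \<Rightarrow> 'm \<Rightarrow> bool" where
  "inflation \<E> i \<longleftrightarrow> (\<exists>p. (i, p) \<in> \<E>)"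

definition deflation :: "('m \<times> 'm) set \<Rightarrow> 'm \<Rightarrow> bool" where
  "deflation \<E> p \<longleftrightarrow> (\<exists>i. (i, p) \<in> \<E>)"

locale exact_category = additive_category C for C :: "('o, 'm) cat" (structure) +
  fixes \<E> :: "('m \<times> 'm) set"
  assumes conflation_exact: "(i, p) \<in> \<E> \<Longrightarrow> exact_pair C i p"
    and conflation_iso: "\<lbrakk>(i, p) \<in> \<E>; exact_pair C i' p'; pair_iso C (i, p) (i', p')\<rbrakk>
      \<Longrightarrow> (i', p') \<in> \<E>"
    and zero_deflation: "zero_object C Z \<Longrightarrow> deflation \<E> (ident C Z)"
    and deflation_comp: "\<lbrakk>deflation \<E> p; deflation \<E> q; Dom C q = Cod C p\<rbrakk> \<Longrightarrow> deflation \<E> (q \<cdot> p)"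
    and inflation_comp: "\<lbrakk>inflation \<E> i; inflation \<E> j; Dom C j = Cod C i\<rbrakk> \<Longrightarrow> inflation \<E> (j \<cdot> i)"
    and pullback_exists: "\<lbrakk>deflation \<E> p; f \<in> Arr C; Cod C f = Cod C p\<rbrakk>
      \<Longrightarrow> \<exists>q g. is_pullback C p f q g"
    and pullback_deflation: "\<lbrakk>deflation \<E> p; is_pullback C p f q g\<rbrakk> \<Longrightarrow> deflation \<E> q"
    and pushout_exists: "\<lbrakk>inflation \<E> i; f \<in> Arr C; Dom C f = Dom C i\<rbrakk>
      \<Longrightarrow> \<exists>j g. is_pushout C i f j g"
    and pushout_inflation: "\<lbrakk>inflation \<E> i; is_pushout C i f j g\<rbrakk> \<Longrightarrow> inflation \<E> j"

definition projective_object :: "('o, 'm) cat \<Rightarrow> ('m \<times> 'm) set \<Rightarrow> 'o \<Rightarrow> bool" where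
  "projective_object C \<E> P \<longleftrightarrow> P \<in> Obj C \<and>
     (\<forall>p f. deflation \<E> p \<and> f \<in> Hom C P (Cod C p) \<longrightarrow> (\<exists>g\<in>Hom C P (Dom C p). p \<cdot>\<^bsub>C\<^esub> g = f))"

definition injective_object :: "('o, 'm) cat \<Rightarrow> ('m \<times> 'm) set \<Rightarrow> 'o \<Rightarrow> bool" where
  "injective_object C \<E> I \<longleftrightarrow> I \<in> Obj C \<and>
     (\<forall>i f. inflation \<E> i \<and> f \<in> Hom C (Dom C i) I \<longrightarrow> (\<exists>g\<in>Hom C (Cod C i) I. g \<cdot>\<^bsub>C\<^esub> i = f))"

locale frobenius_category = exact_category +
  assumes enough_projectives: "A \<in> Obj C
      \<Longrightarrow> \<exists>P p. projective_object C \<E> P \<and> p \<in> Hom C P A \<and> deflation \<E> p"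
    and enough_injectives: "A \<in> Obj C
      \<Longrightarrow> \<exists>I i. injective_object C \<E> I \<and> i \<in> Hom C A I \<and> inflation \<E> i"
    and projective_iff_injective: "A \<in> Obj C
      \<Longrightarrow> projective_object C \<E> A \<longleftrightarrow> injective_object C \<E> A"


section \<open>The category of complexes\<close>

record ('o, 'm) cochain =
  trm :: "int \<Rightarrow> 'o"
  dif :: "int \<Rightarrow> 'm"

record ('o, 'm) chain_map =
  src :: "('o, 'm) cochain"
  tgt :: "('o, 'm) cochain"
  cmp :: "int \<Rightarrow> 'm"

definition is_complex :: "('o, 'm) cat \<Rightarrow> ('o, 'm) cochain \<Rightarrow> bool" where
  "is_complex B X \<longleftrightarrow>
     (\<forall>n. trm X n \<in> Obj B) \<and>
     (\<forall>n. dif X n \<in> Hom B (trm X n) (trm X (n + 1))) \<and>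
     (\<forall>n. dif X (n + 1) \<cdot>\<^bsub>B\<^esub> dif X n = Zero B (trm X n) (trm X (n + 2)))"

definition is_chain_map :: "('o, 'm) cat \<Rightarrow> ('o, 'm) chain_map \<Rightarrow> bool" where
  "is_chain_map B f \<longleftrightarrow> is_complex B (src f) \<and> is_complex B (tgt f) \<and>
     (\<forall>n. cmp f n \<in> Hom B (trm (src f) n) (trm (tgt f) n)) \<and>
     (\<forall>n. dif (tgt f) n \<cdot>\<^bsub>B\<^esub> cmp f n = cmp f (n + 1) \<cdot>\<^bsub>B\<^esub> dif (src f) n)"

definition Cpx :: "('o, 'm) cat \<Rightarrow> (('o, 'm) cochain, ('o, 'm) chain_map) cat" where
  "Cpx B = \<lparr>
     Obj = {X. is_complex B X},
     Arr = {f. is_chain_map B f},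
     Dom = src,
     Cod = tgt,
     ident = (\<lambda>X. \<lparr>src = X, tgt = X, cmp = (\<lambda>n. ident B (trm X n))\<rparr>),
     Comp = (\<lambda>g f. \<lparr>src = src f, tgt = tgt g, cmp = (\<lambda>n. cmp g n \<cdot>\<^bsub>B\<^esub> cmp f n)\<rparr>),
     Add = (\<lambda>f g. \<lparr>src = src f, tgt = tgt f, cmp = (\<lambda>n. cmp f n \<boxplus>\<^bsub>B\<^esub> cmp g n)\<rparr>),
     Zero = (\<lambda>X Y. \<lparr>src = X, tgt = Y, cmp = (\<lambda>n. Zero B (trm X n) (trm Y n))\<rparr>)\<rparr>"

definition cpx_shift :: "('o, 'm) cat \<Rightarrow> ('o, 'm) cochain \<Rightarrow> ('o, 'm) cochain" where
  "cpx_shift B X = \<lparr>trm = (\<lambda>n. trm X (n + 1)), dif = (\<lambda>n. Neg B (dif X (n + 1)))\<rparr>"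

definition cone_term :: "('o, 'm) cat \<Rightarrow> ('o, 'm) chain_map \<Rightarrow> int \<Rightarrow> ('o, 'm) biproduct" where
  "cone_term B f n = dsum B (trm (src f) (n + 1)) (trm (tgt f) n)"

definition cone :: "('o, 'm) cat \<Rightarrow> ('o, 'm) chain_map \<Rightarrow> ('o, 'm) cochain" where
  "cone B f = \<lparr>
     trm = (\<lambda>n. bp_obj (cone_term B f n)),
     dif = (\<lambda>n. matrix B (cone_term B f n) (cone_term B f (n + 1))
              (Neg B (dif (src f) (n + 1))) (Zero B (trm (tgt f) n) (trm (src f) (n + 2)))
              (cmp f (n + 1))               (dif (tgt f) n))\<rparr>"

definition cone_in :: "('o, 'm) cat \<Rightarrow> ('o, 'm) chain_map \<Rightarrow> ('o, 'm) chain_map" where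
  "cone_in B f = \<lparr>src = tgt f, tgt = cone B f, cmp = (\<lambda>n. bp_in2 (cone_term B f n))\<rparr>"

definition cone_out :: "('o, 'm) cat \<Rightarrow> ('o, 'm) chain_map \<Rightarrow> ('o, 'm) chain_map" where
  "cone_out B f = \<lparr>src = cone B f, tgt = cpx_shift B (src f), cmp = (\<lambda>n. bp_pr1 (cone_term B f n))\<rparr>"

definition cpx_fctr :: "('o, 'm, 'p, 'n) fctr
    \<Rightarrow> (('o, 'm) cochain, ('o, 'm) chain_map, ('p, 'n) cochain, ('p, 'n) chain_map) fctr" where
  "cpx_fctr F = (let F\<^sub>0 = (\<lambda>X. \<lparr>trm = (\<lambda>n. on_obj F (trm X n)), dif = (\<lambda>n. on_arr F (dif X n))\<rparr>)
     in \<lparr>on_obj = F\<^sub>0,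
         on_arr = (\<lambda>f. \<lparr>src = F\<^sub>0 (src f), tgt = F\<^sub>0 (tgt f), cmp = (\<lambda>n. on_arr F (cmp f n))\<rparr>)\<rparr>)"

definition cpx_eta :: "('o, 'm, 'o, 'm) fctr \<Rightarrow> ('o \<Rightarrow> 'm) \<Rightarrow> ('o, 'm) cochain \<Rightarrow> ('o, 'm) chain_map"
  where
  "cpx_eta T \<eta> X = \<lparr>src = on_obj (cpx_fctr T) X, tgt = X, cmp = (\<lambda>n. \<eta> (trm X n))\<rparr>"


section \<open>\<open>\<eta>\<close>-conflations\<close>

definition factors_through_eta :: "('o, 'm) cat \<Rightarrow> ('o, 'm, 'o, 'm) fctr \<Rightarrow> ('o \<Rightarrow> 'm)
    \<Rightarrow> ('o, 'm) chain_map \<Rightarrow> bool" where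
  "factors_through_eta B T \<eta> f \<longleftrightarrow>
     (\<exists>g\<in>Hom (Cpx B) (src f) (on_obj (cpx_fctr T) (tgt f)). f = cpx_eta T \<eta> (tgt f) \<cdot>\<^bsub>Cpx B\<^esub> g)"

definition standard_eta_conflations :: "('o, 'm) cat \<Rightarrow> ('o, 'm, 'o, 'm) fctr \<Rightarrow> ('o \<Rightarrow> 'm)
    \<Rightarrow> (('o, 'm) chain_map \<times> ('o, 'm) chain_map) set" where
  "standard_eta_conflations B T \<eta> =
     {(cone_in B f, cone_out B f) | f. f \<in> Arr (Cpx B) \<and> factors_through_eta B T \<eta> f}"

definition eta_conflations :: "('o, 'm) cat \<Rightarrow> ('o, 'm, 'o, 'm) fctr \<Rightarrow> ('o \<Rightarrow> 'm)
    \<Rightarrow> (('o, 'm) chain_map \<times> ('o, 'm) chain_map) set" where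
  "eta_conflations B T \<eta> =
     {(i, p). exact_pair (Cpx B) i p \<and>
        (\<exists>s\<in>standard_eta_conflations B T \<eta>. pair_iso (Cpx B) (i, p) s)}"

end

theory Submission
  imports Defs
begin

text \<open>
  Write \<open>(1)\<close> for \<open>T\<close> and \<open>d\<close> for all differentials.  Consider a sequence \<open>Y \<rightarrow> E \<rightarrow> Z\<close> of complexes, with maps
  \<open>i\<close> and \<open>p\<close>, that is split in every degree by retractions \<open>r\<close> and sections \<open>s\<close>.  The maps
  \<open>k = r d s\<close> from \<open>Z\<^sup>n\<close> to \<open>Y\<^sup>n\<^sup>+\<^sup>1\<close> measure how far the splitting is from being one of complexes:
  \<open>d s = s d + i k\<close> and \<open>r d = d r + k p\<close>.  They anticommute with \<open>d\<close>, they determine the sequence up to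
  isomorphism, and every such \<open>k\<close> occurs, in the cone of the map that \<open>k\<close> defines from \<open>Z[-1]\<close> to \<open>Y\<close>
  (\<open>extension_exists\<close>, \<open>split_seq_iso\<close>).  The \<open>\<eta>\<close>-conflations are therefore the sequences that have a
  splitting with \<open>k = \<eta> g\<close>, where the maps \<open>g\<close> from \<open>Z\<^sup>n\<close> to \<open>Y(1)\<^sup>n\<^sup>+\<^sup>1\<close> anticommute with \<open>d\<close>
  (\<open>eta_conflationI\<close>, \<open>eta_conflationD\<close>).  In this form each axiom is a computation with \<open>g\<close>.

  Pulling back along \<open>f\<close> replaces \<open>g\<close> by \<open>g f\<close>.  Pushing out along \<open>u\<close> replaces \<open>g\<close> by \<open>u(1) g\<close>, because
  \<open>u \<eta> = \<eta> u(1)\<close>.  For deflations \<open>E \<rightarrow> Z \<rightarrow> W\<close> with kernels \<open>Y\<close> and \<open>j : V \<rightarrow> Z\<close> and with data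
  \<open>(r, s, g)\<close> and \<open>(r', s', g')\<close>, the composite has as kernel the pullback \<open>K\<close> of \<open>E\<close> along \<open>j\<close>, and it is
  split by \<open>s s'\<close>.  If \<open>i\<^sub>K\<close> and \<open>s\<^sub>K\<close> denote the inclusion of \<open>Y\<close> and the section of \<open>V\<close> in \<open>K\<close>, its cocycle
  is \<open>i\<^sub>K(1) g s' + s\<^sub>K(1) g'\<close>.  Neither summand is a cocycle, since \<open>s'\<close> and \<open>s\<^sub>K(1)\<close> do not commute with
  \<open>d\<close>.  The two defects are \<open>g j \<eta> g'\<close> and \<open>\<eta>\<^sub>Y(1) g(1) j(1) g'\<close>, preceded by \<open>i\<^sub>K(1)\<close>; here \<open>\<eta>\<^sub>Y(1)\<close> is
  \<open>\<eta>\<close> at \<open>Y(1)\<close> by hypothesis, so by naturality they are equal, and they cancel because of their opposite signs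
  (\<open>eta_deflation_comp\<close>).  Inflations are treated dually (\<open>eta_inflation_comp\<close>).

  Call a complex \<open>X\<close> \<open>\<eta>\<close>-contractible if \<open>\<eta>\<^sub>X = d \<sigma> + \<sigma> d\<close> for some \<open>\<sigma>\<close>.  The obstruction to extending
  \<open>w : Y \<rightarrow> X\<close> over an inflation is \<open>w \<eta> g = \<eta>\<^sub>X w(1) g\<close>, and the obstruction to lifting \<open>w : X \<rightarrow> Z\<close> through
  a deflation is \<open>\<eta> g w = h \<eta>\<close> with \<open>h = (g w)(-1)\<close>; both are null-homotopic when \<open>X\<close> is \<open>\<eta>\<close>-contractible.
  So \<open>\<eta>\<close>-contractible complexes are injective and projective.  There are enough of them: the extension of
  \<open>Y(1)[1]\<close> by \<open>Y\<close> with \<open>g\<close> the identity is \<open>\<eta>\<close>-contractible (\<open>eta_contractible_extension\<close>).  It contains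
  \<open>Y\<close>, and for \<open>Y = A(-1)[-1]\<close> it maps onto \<open>A\<close>.  As \<open>\<eta>\<close>-contractibility passes to retracts, the
  projective objects, the injective objects and the \<open>\<eta>\<close>-contractible complexes are the same.
\<close>

section \<open>Calculation with morphisms\<close>

context category
begin

lemma Hom_iff: "f \<in> Hom C A B \<longleftrightarrow> f \<in> Arr C \<and> Dom C f = A \<and> Cod C f = B"
  by (simp add: Hom_def)

declare dom_obj [simp] cod_obj [simp]

text \<open>
  Typing is expressed by equations for \<open>Dom\<close> and \<open>Cod\<close> and not by membership in \<open>Hom\<close>, so that the side
  conditions of all later rewrite rules are decided by simplification without guessing intermediate objects.
\<close>
lemma comp_typed [simp]:
  assumes "f \<in> Arr C" "g \<in> Arr C" "Dom C g = Cod C f"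
  shows "g \<cdot> f \<in> Arr C" "Dom C (g \<cdot> f) = Dom C f" "Cod C (g \<cdot> f) = Cod C g"
  using comp_hom[of f "Dom C f" "Cod C f" g "Cod C g"] assms by (auto simp: Hom_iff)

lemma ident_typed [simp]:
  assumes "A \<in> Obj C"
  shows "ident C A \<in> Arr C" "Dom C (ident C A) = A" "Cod C (ident C A) = A"
  using ident_hom[OF assms] by (auto simp: Hom_iff)

lemma comp_ident [simp]:
  "\<lbrakk>f \<in> Arr C; Dom C f = A\<rbrakk> \<Longrightarrow> f \<cdot> ident C A = f"
  "\<lbrakk>f \<in> Arr C; Cod C f = A\<rbrakk> \<Longrightarrow> ident C A \<cdot> f = f"
  using comp_ident_left comp_ident_right by (auto simp: Hom_iff)

lemma comp_assoc_typed [simp]: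
  "\<lbrakk>f \<in> Arr C; g \<in> Arr C; h \<in> Arr C; Dom C g = Cod C f; Dom C h = Cod C g\<rbrakk>
   \<Longrightarrow> (h \<cdot> g) \<cdot> f = h \<cdot> (g \<cdot> f)"
  using comp_assoc[of f "Dom C f" "Cod C f" g "Cod C g" h "Cod C h"] by (simp add: Hom_iff)

text \<open>
  Composites are kept associated to the right.  This turns an equation for a composite \<open>a \<cdot> b\<close> into one
  that applies when \<open>b\<close> is followed by further factors.
\<close>
lemma comp_rewrite:
  "\<lbrakk>a \<cdot> b = c; x \<in> Arr C; b \<in> Arr C; a \<in> Arr C; Dom C a = Cod C b; Cod C x = Dom C b\<rbrakk>
   \<Longrightarrow> a \<cdot> (b \<cdot> x) = c \<cdot> x"
  by (metis comp_assoc_typed)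

end

context preadditive_category
begin

lemma add_typed [simp]:
  assumes "f \<in> Arr C" "g \<in> Arr C" "Dom C g = Dom C f" "Cod C g = Cod C f"
  shows "f \<boxplus> g \<in> Arr C" "Dom C (f \<boxplus> g) = Dom C f" "Cod C (f \<boxplus> g) = Cod C f"
proof -
  interpret G: comm_group "Hom_group C (Dom C f) (Cod C f)" using assms by (intro hom_comm_group) auto
  have "f \<boxplus> g \<in> Hom C (Dom C f) (Cod C f)"
    using G.m_closed[of f g] assms by (auto simp: Hom_group_def Hom_iff)
  then show "f \<boxplus> g \<in> Arr C" "Dom C (f \<boxplus> g) = Dom C f" "Cod C (f \<boxplus> g) = Cod C f"
    by (auto simp: Hom_iff)
qed

lemma zero_typed [simp]:
  assumes "A \<in> Obj C" "B \<in> Obj C"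
  shows "Zero C A B \<in> Arr C" "Dom C (Zero C A B) = A" "Cod C (Zero C A B) = B"
proof -
  interpret G: comm_group "Hom_group C A B" using assms by (intro hom_comm_group) auto
  have "Zero C A B \<in> Hom C A B" using G.one_closed by (auto simp: Hom_group_def)
  then show "Zero C A B \<in> Arr C" "Dom C (Zero C A B) = A" "Cod C (Zero C A B) = B"
    by (auto simp: Hom_iff)
qed

lemma neg_typed [simp]:
  assumes "f \<in> Arr C"
  shows "Neg C f \<in> Arr C" "Dom C (Neg C f) = Dom C f" "Cod C (Neg C f) = Cod C f"
    and add_neg: "f \<boxplus> Neg C f = Zero C (Dom C f) (Cod C f)"
proof -
  interpret G: comm_group "Hom_group C (Dom C f) (Cod C f)" using assms by (intro hom_comm_group) auto
  have f: "f \<in> carrier (Hom_group C (Dom C f) (Cod C f))" using assms by (simp add: Hom_group_def Hom_iff)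
  have "Neg C f \<in> Hom C (Dom C f) (Cod C f)"
    using G.inv_closed[OF f] by (auto simp: Hom_group_def Neg_def)
  then show "Neg C f \<in> Arr C" "Dom C (Neg C f) = Dom C f" "Cod C (Neg C f) = Cod C f"
    by (auto simp: Hom_iff)
  show "f \<boxplus> Neg C f = Zero C (Dom C f) (Cod C f)"
    using G.r_inv[OF f] by (simp add: Hom_group_def Neg_def)
qed

lemma add_laws:
  assumes "f \<in> Arr C" "g \<in> Arr C" "h \<in> Arr C" "Dom C g = Dom C f" "Cod C g = Cod C f"
    "Dom C h = Dom C f" "Cod C h = Cod C f"
  shows add_assoc: "(f \<boxplus> g) \<boxplus> h = f \<boxplus> (g \<boxplus> h)"
    and add_left_comm: "f \<boxplus> (g \<boxplus> h) = g \<boxplus> (f \<boxplus> h)"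
proof -
  interpret G: comm_group "Hom_group C (Dom C f) (Cod C f)" using assms by (intro hom_comm_group) auto
  show "(f \<boxplus> g) \<boxplus> h = f \<boxplus> (g \<boxplus> h)"
    using G.m_assoc[of f g h] assms by (auto simp: Hom_group_def Hom_iff)
  show "f \<boxplus> (g \<boxplus> h) = g \<boxplus> (f \<boxplus> h)"
    using G.m_lcomm[of f g h] assms by (auto simp: Hom_group_def Hom_iff)
qed

lemma add_comm:
  assumes "f \<in> Arr C" "g \<in> Arr C" "Dom C g = Dom C f" "Cod C g = Cod C f"
  shows "f \<boxplus> g = g \<boxplus> f"
proof -
  interpret G: comm_group "Hom_group C (Dom C f) (Cod C f)" using assms by (intro hom_comm_group) auto
  show ?thesis using G.m_comm[of f g] assms by (auto simp: Hom_group_def Hom_iff)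
qed

lemmas add_ac = add_assoc add_comm add_left_comm

lemma add_zero [simp]:
  assumes "f \<in> Arr C" "Dom C f = A" "Cod C f = B"
  shows "f \<boxplus> Zero C A B = f" "Zero C A B \<boxplus> f = f"
proof -
  interpret G: comm_group "Hom_group C (Dom C f) (Cod C f)" using assms by (intro hom_comm_group) auto
  show "f \<boxplus> Zero C A B = f" "Zero C A B \<boxplus> f = f"
    using G.r_one[of f] G.l_one[of f] assms by (auto simp: Hom_group_def Hom_iff)
qed

lemma add_cancel:
  assumes "f \<boxplus> g = f \<boxplus> h"
    "f \<in> Arr C" "g \<in> Arr C" "h \<in> Arr C" "Dom C g = Dom C f" "Cod C g = Cod C f"
    "Dom C h = Dom C f" "Cod C h = Cod C f"
  shows "g = h"
proof -
  interpret G: comm_group "Hom_group C (Dom C f) (Cod C f)" using assms by (intro hom_comm_group) auto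
  show ?thesis using G.Units_l_cancel[of f g h, unfolded G.Units_eq] assms by (auto simp: Hom_group_def Hom_iff)
qed

lemma neg_eqI:
  assumes "f \<boxplus> g = Zero C A B" "f \<in> Arr C" "g \<in> Arr C"
    "Dom C f = A" "Dom C g = A" "Cod C f = B" "Cod C g = B"
  shows "Neg C f = g"
  using add_cancel[of f "Neg C f" g] add_neg[of f] assms by simp

lemma comp_add [simp]:
  "\<lbrakk>f \<in> Arr C; g \<in> Arr C; h \<in> Arr C; Dom C g = Cod C f; Dom C h = Dom C g; Cod C h = Cod C g\<rbrakk>
   \<Longrightarrow> (g \<boxplus> h) \<cdot> f = (g \<cdot> f) \<boxplus> (h \<cdot> f)"
  "\<lbrakk>f \<in> Arr C; g \<in> Arr C; h \<in> Arr C; Dom C h = Cod C f; Dom C g = Dom C f; Cod C g = Cod C f\<rbrakk>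
   \<Longrightarrow> h \<cdot> (f \<boxplus> g) = (h \<cdot> f) \<boxplus> (h \<cdot> g)"
  using comp_add_left[of f "Dom C f" "Cod C f" g "Cod C g" h]
    comp_add_right[of f "Dom C f" "Cod C f" g h "Cod C h"] by (auto simp: Hom_iff)

lemma comp_zero [simp]:
  "\<lbrakk>f \<in> Arr C; Cod C f = A; B \<in> Obj C\<rbrakk> \<Longrightarrow> Zero C A B \<cdot> f = Zero C (Dom C f) B"
  "\<lbrakk>f \<in> Arr C; Dom C f = B; A \<in> Obj C\<rbrakk> \<Longrightarrow> f \<cdot> Zero C A B = Zero C A (Cod C f)"
proof -
  assume f: "f \<in> Arr C" "Cod C f = A" "B \<in> Obj C"
  then have A: "A \<in> Obj C" by auto
  have "(Zero C A B \<boxplus> Zero C A B) \<cdot> f = (Zero C A B \<cdot> f) \<boxplus> (Zero C A B \<cdot> f)"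
    using f A by (intro comp_add) auto
  then have "Zero C A B \<cdot> f \<boxplus> Zero C A B \<cdot> f = Zero C A B \<cdot> f \<boxplus> Zero C (Dom C f) B" using f A by simp
  then show "Zero C A B \<cdot> f = Zero C (Dom C f) B"
    by (rule add_cancel) (use f A in auto)
next
  assume f: "f \<in> Arr C" "Dom C f = B" "A \<in> Obj C"
  then have B: "B \<in> Obj C" by auto
  have "f \<cdot> (Zero C A B \<boxplus> Zero C A B) = (f \<cdot> Zero C A B) \<boxplus> (f \<cdot> Zero C A B)"
    using f B by (intro comp_add) auto
  then have "f \<cdot> Zero C A B \<boxplus> f \<cdot> Zero C A B = f \<cdot> Zero C A B \<boxplus> Zero C A (Cod C f)" using f B by simp
  then show "f \<cdot> Zero C A B = Zero C A (Cod C f)"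
    by (rule add_cancel) (use f B in auto)
qed

lemma comp_neg [simp]:
  assumes "f \<in> Arr C" "g \<in> Arr C" "Dom C g = Cod C f"
  shows "Neg C g \<cdot> f = Neg C (g \<cdot> f)" "g \<cdot> Neg C f = Neg C (g \<cdot> f)"
proof -
  have "g \<cdot> f \<boxplus> Neg C g \<cdot> f = (g \<boxplus> Neg C g) \<cdot> f"
    using assms by (intro comp_add(1)[symmetric]) auto
  also have "\<dots> = Zero C (Dom C f) (Cod C g)" using assms by simp
  finally show "Neg C g \<cdot> f = Neg C (g \<cdot> f)"
    using assms by (intro neg_eqI[symmetric, where A = "Dom C f" and B = "Cod C g"]) auto
  have "g \<cdot> f \<boxplus> g \<cdot> Neg C f = g \<cdot> (f \<boxplus> Neg C f)"
    using assms by (intro comp_add(2)[symmetric]) auto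
  also have "\<dots> = Zero C (Dom C f) (Cod C g)" using assms by simp
  finally show "g \<cdot> Neg C f = Neg C (g \<cdot> f)"
    using assms by (intro neg_eqI[symmetric, where A = "Dom C f" and B = "Cod C g"]) auto
qed

lemma neg_neg [simp]: "f \<in> Arr C \<Longrightarrow> Neg C (Neg C f) = f"
  by (rule neg_eqI[where A = "Dom C f" and B = "Cod C f"])
    (auto simp: add_neg add_comm[of "Neg C f" f])

lemma neg_zero [simp]: "\<lbrakk>A \<in> Obj C; B \<in> Obj C\<rbrakk> \<Longrightarrow> Neg C (Zero C A B) = Zero C A B"
  by (rule neg_eqI[where A = A and B = B]) auto

lemma neg_add_self [simp]: "f \<in> Arr C \<Longrightarrow> Neg C f \<boxplus> f = Zero C (Dom C f) (Cod C f)"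
  by (simp add: add_comm[of "Neg C f" f] add_neg)

lemma add_eq_zeroD:
  assumes "f \<boxplus> g = Zero C A B" "f \<in> Arr C" "g \<in> Arr C"
    "Dom C f = A" "Dom C g = A" "Cod C f = B" "Cod C g = B"
  shows "g = Neg C f"
  using neg_eqI[OF assms] by simp

lemma neg_add:
  assumes "f \<in> Arr C" "g \<in> Arr C" "Dom C g = Dom C f" "Cod C g = Cod C f"
  shows "Neg C (f \<boxplus> g) = Neg C f \<boxplus> Neg C g"
proof (rule neg_eqI[where A = "Dom C f" and B = "Cod C f"])
  have "(f \<boxplus> g) \<boxplus> (Neg C f \<boxplus> Neg C g) = (f \<boxplus> Neg C f) \<boxplus> (g \<boxplus> Neg C g)"
    using assms by (simp add: add_assoc add_left_comm[of "g" "Neg C f"] del: add_neg neg_add_self)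
  also have "\<dots> = Zero C (Dom C f) (Cod C f)" using assms by simp
  finally show "(f \<boxplus> g) \<boxplus> (Neg C f \<boxplus> Neg C g) = Zero C (Dom C f) (Cod C f)" .
qed (use assms in auto)

end

lemma (in preadditive_category) add_cancel_pair:
  assumes "a \<in> Arr C" "b \<in> Arr C" "x \<in> Arr C" "Dom C b = Dom C a" "Cod C b = Cod C a"
    "Dom C x = Dom C a" "Cod C x = Cod C a"
  shows "(a \<boxplus> x) \<boxplus> (b \<boxplus> Neg C x) = a \<boxplus> b"
proof -
  have "(a \<boxplus> x) \<boxplus> (b \<boxplus> Neg C x) = a \<boxplus> (b \<boxplus> (x \<boxplus> Neg C x))"
    using assms by (simp add: add_assoc add_left_comm[of x b] del: add_neg)
  then show ?thesis using assms by simp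
qed

lemma (in preadditive_category) add_cancel_pair':
  assumes "a \<in> Arr C" "x \<in> Arr C" "y \<in> Arr C" "Dom C x = Dom C a" "Cod C x = Cod C a"
    "Dom C y = Dom C a" "Cod C y = Cod C a"
  shows "(Neg C a \<boxplus> x) \<boxplus> (a \<boxplus> y) = x \<boxplus> y"
  using add_cancel_pair[of x y "Neg C a"] assms add_comm[of x "Neg C a"] add_comm[of y a] by simp

lemma (in preadditive_category) add_eq_left:
  assumes "a \<boxplus> b = c" "a \<in> Arr C" "b \<in> Arr C" "Dom C b = Dom C a" "Cod C b = Cod C a"
  shows "a = c \<boxplus> Neg C b"
  using assms add_cancel_pair[of a "Zero C (Dom C a) (Cod C a)" b] by auto

lemma (in preadditive_category) add_eq_right:
  assumes "a \<boxplus> b = c" "a \<in> Arr C" "b \<in> Arr C" "Dom C b = Dom C a" "Cod C b = Cod C a"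
  shows "b = c \<boxplus> Neg C a"
  using assms add_eq_left[of b a c] add_comm[of a b] by auto

section \<open>Isomorphisms, pullbacks and pushouts\<close>

context category
begin

lemma iso_arrE:
  assumes "iso_arr C a" "a \<in> Hom C X Y"
  obtains a' where "a' \<in> Hom C Y X" "a' \<cdot> a = ident C X" "a \<cdot> a' = ident C Y"
proof -
  have "Dom C a = X" "Cod C a = Y" using assms(2) by (auto simp: Hom_iff)
  then show thesis using assms(1) that unfolding iso_arr_def by metis
qed

lemma iso_arrI:
  assumes "a \<in> Hom C X Y" "a' \<in> Hom C Y X" "a' \<cdot> a = ident C X" "a \<cdot> a' = ident C Y"
  shows "iso_arr C a"
proof -
  have "a \<in> Arr C" "Dom C a = X" "Cod C a = Y" using assms(1) by (auto simp: Hom_iff)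
  then show ?thesis using assms(2-4) unfolding iso_arr_def by metis
qed

lemma iso_arr_ident: "X \<in> Obj C \<Longrightarrow> iso_arr C (ident C X)"
  by (rule iso_arrI[of _ X X "ident C X"]) (auto simp: Hom_iff)

lemma commuting_square_inverse:
  assumes a: "a \<in> Hom C X X'" "a' \<in> Hom C X' X" "a' \<cdot> a = ident C X" "a \<cdot> a' = ident C X'"
    and b: "b \<in> Hom C Y Y'" "b' \<in> Hom C Y' Y" "b' \<cdot> b = ident C Y" "b \<cdot> b' = ident C Y'"
    and f: "f \<in> Hom C X Y" "f' \<in> Hom C X' Y'" "b \<cdot> f = f' \<cdot> a"
  shows "b' \<cdot> f' = f \<cdot> a'"
proof -
  note ty [simp] = a(1,2)[unfolded Hom_iff] b(1,2)[unfolded Hom_iff] f(1,2)[unfolded Hom_iff]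
  have "f' = f' \<cdot> (a \<cdot> a')" using a(4) by simp
  also have "\<dots> = b \<cdot> (f \<cdot> a')" using comp_rewrite[OF f(3), of a'] by simp
  finally have "b' \<cdot> f' = b' \<cdot> (b \<cdot> (f \<cdot> a'))" by metis
  then show ?thesis using comp_rewrite[OF b(3), of "f \<cdot> a'"] by simp
qed

text \<open>
  Needed because \<^const>\<open>eta_conflations\<close> and \<^const>\<open>exact_category\<close> orient isomorphisms of pairs in
  opposite directions.
\<close>
lemma pair_iso_sym:
  assumes "pair_iso C (i, p) (i', p')" "i \<in> Arr C" "p \<in> Arr C" "Cod C i = Dom C p"
    "i' \<in> Arr C" "p' \<in> Arr C" "Cod C i' = Dom C p'"
  shows "pair_iso C (i', p') (i, p)"
proof -
  from assms(1) obtain a b c where abc: "a \<in> Hom C (Dom C i) (Dom C i')" "b \<in> Hom C (Cod C i) (Cod C i')"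
      "c \<in> Hom C (Cod C p) (Cod C p')"
    and iso: "iso_arr C a" "iso_arr C b" "iso_arr C c"
    and comm: "b \<cdot> i = i' \<cdot> a" "c \<cdot> p = p' \<cdot> b"
    unfolding pair_iso_def prod.case by blast
  obtain a' where a': "a' \<in> Hom C (Dom C i') (Dom C i)" "a' \<cdot> a = ident C (Dom C i)" "a \<cdot> a' = ident C (Dom C i')"
    using iso_arrE[OF iso(1) abc(1)] .
  obtain b' where b': "b' \<in> Hom C (Cod C i') (Cod C i)" "b' \<cdot> b = ident C (Cod C i)" "b \<cdot> b' = ident C (Cod C i')"
    using iso_arrE[OF iso(2) abc(2)] .
  obtain c' where c': "c' \<in> Hom C (Cod C p') (Cod C p)" "c' \<cdot> c = ident C (Cod C p)" "c \<cdot> c' = ident C (Cod C p')"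
    using iso_arrE[OF iso(3) abc(3)] .
  have "b' \<cdot> i' = i \<cdot> a'"
    by (rule commuting_square_inverse[OF abc(1) a' abc(2) b' _ _ comm(1)]) (use assms in \<open>auto simp: Hom_iff\<close>)
  moreover have "c' \<cdot> p' = p \<cdot> b'"
    by (rule commuting_square_inverse[OF abc(2) b' abc(3) c' _ _ comm(2)]) (use assms in \<open>auto simp: Hom_iff\<close>)
  ultimately show ?thesis
    unfolding pair_iso_def prod.case
    using a'(1) b'(1) c'(1) iso_arrI[OF a'(1) abc(1) a'(3,2)] iso_arrI[OF b'(1) abc(2) b'(3,2)]
      iso_arrI[OF c'(1) abc(3) c'(3,2)] by blast
qed

lemma pullback_unique:
  assumes "is_pullback C p f q g" "is_pullback C p f q' g'"
  shows "\<exists>t t'. t \<in> Hom C (Dom C q) (Dom C q') \<and> t' \<in> Hom C (Dom C q') (Dom C q) \<and>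
    t' \<cdot> t = ident C (Dom C q) \<and> t \<cdot> t' = ident C (Dom C q') \<and> q' \<cdot> t = q"
proof -
  have *: "\<exists>t. t \<in> Hom C (Dom C q) (Dom C q') \<and> g' \<cdot> t = g \<and> q' \<cdot> t = q"
    if "is_pullback C p f q g" "is_pullback C p f q' g'" for q g q' g'
  proof -
    have "Dom C q \<in> Obj C" "g \<in> Hom C (Dom C q) (Dom C p)" "q \<in> Hom C (Dom C q) (Dom C f)" "p \<cdot> g = f \<cdot> q"
      using that(1) unfolding is_pullback_def Hom_iff by auto
    then show ?thesis using that(2) unfolding is_pullback_def by blast
  qed
  have uniq: "t = ident C (Dom C q)"
    if pb: "is_pullback C p f q g" and t: "t \<in> Hom C (Dom C q) (Dom C q)" "g \<cdot> t = g" "q \<cdot> t = q" for q g t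
  proof -
    have ty: "g \<in> Hom C (Dom C q) (Dom C p)" "q \<in> Hom C (Dom C q) (Dom C f)" "p \<cdot> g = f \<cdot> q" "Dom C q \<in> Obj C"
      using pb unfolding is_pullback_def Hom_iff by auto
    then have "\<exists>!u. u \<in> Hom C (Dom C q) (Dom C q) \<and> g \<cdot> u = g \<and> q \<cdot> u = q"
      using pb unfolding is_pullback_def by blast
    moreover have "ident C (Dom C q) \<in> Hom C (Dom C q) (Dom C q) \<and> g \<cdot> ident C (Dom C q) = g \<and> q \<cdot> ident C (Dom C q) = q"
      using ty by (auto simp: Hom_iff)
    ultimately show ?thesis using t by blast
  qed
  obtain t where t: "t \<in> Hom C (Dom C q) (Dom C q')" "g' \<cdot> t = g" "q' \<cdot> t = q"
    using *[OF assms] by blast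
  obtain t' where t': "t' \<in> Hom C (Dom C q') (Dom C q)" "g \<cdot> t' = g'" "q \<cdot> t' = q'"
    using *[OF assms(2,1)] by blast
  have ty: "g \<in> Arr C" "q \<in> Arr C" "Dom C g = Dom C q" "g' \<in> Arr C" "q' \<in> Arr C" "Dom C g' = Dom C q'"
    using assms unfolding is_pullback_def by auto
  have "t' \<cdot> t = ident C (Dom C q)"
    using t t' ty comp_rewrite[OF t'(2), of t] comp_rewrite[OF t'(3), of t]
    by (intro uniq[OF assms(1)]) (simp_all add: Hom_iff)
  moreover have "t \<cdot> t' = ident C (Dom C q')"
    using t t' ty comp_rewrite[OF t(2), of t'] comp_rewrite[OF t(3), of t']
    by (intro uniq[OF assms(2)]) (simp_all add: Hom_iff)
  ultimately show ?thesis using t t' by blast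
qed

lemma pushout_unique:
  assumes "is_pushout C i f j g" "is_pushout C i f j' g'"
  shows "\<exists>t t'. t \<in> Hom C (Cod C j) (Cod C j') \<and> t' \<in> Hom C (Cod C j') (Cod C j) \<and>
    t' \<cdot> t = ident C (Cod C j) \<and> t \<cdot> t' = ident C (Cod C j') \<and> t \<cdot> j = j'"
proof -
  have *: "\<exists>t. t \<in> Hom C (Cod C j) (Cod C j') \<and> t \<cdot> g = g' \<and> t \<cdot> j = j'"
    if "is_pushout C i f j g" "is_pushout C i f j' g'" for j g j' g'
  proof -
    have "Cod C j' \<in> Obj C" "g' \<in> Hom C (Cod C i) (Cod C j')" "j' \<in> Hom C (Cod C f) (Cod C j')" "g' \<cdot> i = j' \<cdot> f"
      using that(2) unfolding is_pushout_def Hom_iff by auto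
    then show ?thesis using that(1) unfolding is_pushout_def by blast
  qed
  have uniq: "t = ident C (Cod C j)"
    if pb: "is_pushout C i f j g" and t: "t \<in> Hom C (Cod C j) (Cod C j)" "t \<cdot> g = g" "t \<cdot> j = j" for j g t
  proof -
    have ty: "g \<in> Hom C (Cod C i) (Cod C j)" "j \<in> Hom C (Cod C f) (Cod C j)" "g \<cdot> i = j \<cdot> f" "Cod C j \<in> Obj C"
      using pb unfolding is_pushout_def Hom_iff by auto
    then have "\<exists>!u. u \<in> Hom C (Cod C j) (Cod C j) \<and> u \<cdot> g = g \<and> u \<cdot> j = j"
      using pb unfolding is_pushout_def by blast
    moreover have "ident C (Cod C j) \<in> Hom C (Cod C j) (Cod C j) \<and> ident C (Cod C j) \<cdot> g = g \<and> ident C (Cod C j) \<cdot> j = j"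
      using ty by (auto simp: Hom_iff)
    ultimately show ?thesis using t by blast
  qed
  obtain t where t: "t \<in> Hom C (Cod C j) (Cod C j')" "t \<cdot> g = g'" "t \<cdot> j = j'"
    using *[OF assms] by blast
  obtain t' where t': "t' \<in> Hom C (Cod C j') (Cod C j)" "t' \<cdot> g' = g" "t' \<cdot> j' = j"
    using *[OF assms(2,1)] by blast
  have ty: "g \<in> Arr C" "j \<in> Arr C" "Cod C g = Cod C j" "g' \<in> Arr C" "j' \<in> Arr C" "Cod C g' = Cod C j'"
    using assms unfolding is_pushout_def by auto
  have "t' \<cdot> t = ident C (Cod C j)"
    using t t' ty by (intro uniq[OF assms(1)]) (simp_all add: Hom_iff)
  moreover have "t \<cdot> t' = ident C (Cod C j')"
    using t t' ty by (intro uniq[OF assms(2)]) (simp_all add: Hom_iff)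
  ultimately show ?thesis using t t' by blast
qed

end

section \<open>Complexes and chain maps\<close>

text \<open>
  A normal form for degrees, so that \<open>trm X\<close> at equal degrees is syntactically equal.
\<close>
lemma int_add_steps [simp]:
  fixes n :: int
  shows "n + 1 + 1 = n + 2" "n + 2 + 1 = n + 3" "n + 1 + 2 = n + 3"
  by simp_all

lemma Cpx_sel [simp]:
  "X \<in> Obj (Cpx B) \<longleftrightarrow> is_complex B X"
  "f \<in> Arr (Cpx B) \<longleftrightarrow> is_chain_map B f"
  "Dom (Cpx B) f = src f" "Cod (Cpx B) f = tgt f"
  "ident (Cpx B) X = \<lparr>src = X, tgt = X, cmp = (\<lambda>n. ident B (trm X n))\<rparr>"
  "g \<cdot>\<^bsub>Cpx B\<^esub> f = \<lparr>src = src f, tgt = tgt g, cmp = (\<lambda>n. cmp g n \<cdot>\<^bsub>B\<^esub> cmp f n)\<rparr>"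
  "f \<boxplus>\<^bsub>Cpx B\<^esub> g = \<lparr>src = src f, tgt = tgt f, cmp = (\<lambda>n. cmp f n \<boxplus>\<^bsub>B\<^esub> cmp g n)\<rparr>"
  "Zero (Cpx B) X Y = \<lparr>src = X, tgt = Y, cmp = (\<lambda>n. Zero B (trm X n) (trm Y n))\<rparr>"
  by (simp_all add: Cpx_def)

lemma Cpx_Hom [simp]: "f \<in> Hom (Cpx B) X Y \<longleftrightarrow> is_chain_map B f \<and> src f = X \<and> tgt f = Y"
  by (simp add: Hom_def)

lemma chain_map_eqI:
  fixes f g :: "('o, 'm) chain_map"
  assumes "src f = src g" "tgt f = tgt g" "\<And>n. cmp f n = cmp g n"
  shows "f = g"
  using assms by (intro chain_map.equality) auto

context preadditive_category
begin

lemma complex_typed [simp]: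
  assumes "is_complex C X"
  shows "trm X n \<in> Obj C" "dif X n \<in> Arr C" "Dom C (dif X n) = trm X n" "Cod C (dif X n) = trm X (n + 1)"
  using assms by (auto simp: is_complex_def Hom_iff)

lemma dif_dif [simp]:
  assumes "is_complex C X" "m = n + 1"
  shows "dif X m \<cdot> dif X n = Zero C (trm X n) (trm X (n + 2))"
  using assms by (auto simp: is_complex_def)

lemma dif_dif_comp [simp]:
  assumes "is_complex C X" "m = n + 1" "x \<in> Arr C" "Cod C x = trm X n"
  shows "dif X m \<cdot> (dif X n \<cdot> x) = Zero C (Dom C x) (trm X (n + 2))"
  using comp_rewrite[OF dif_dif[OF assms(1,2)], of x] assms by simp

lemma chain_typed [simp]:
  assumes "is_chain_map C f"
  shows "is_complex C (src f)" "is_complex C (tgt f)"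
    "cmp f n \<in> Arr C" "Dom C (cmp f n) = trm (src f) n" "Cod C (cmp f n) = trm (tgt f) n"
  using assms by (auto simp: is_chain_map_def Hom_iff)

lemma chain_comm [simp]:
  assumes "is_chain_map C f" "tgt f = Y"
  shows "dif Y n \<cdot> cmp f n = cmp f (n + 1) \<cdot> dif (src f) n"
  using assms unfolding is_chain_map_def by blast

lemma chain_comm_comp [simp]:
  assumes "is_chain_map C f" "tgt f = Y" "x \<in> Arr C" "Cod C x = trm (src f) n"
  shows "dif Y n \<cdot> (cmp f n \<cdot> x) = cmp f (n + 1) \<cdot> (dif (src f) n \<cdot> x)"
  using comp_rewrite[OF chain_comm[OF assms(1,2)], of x] assms by auto

lemma chain_mapI:
  assumes "is_complex C (src f)" "is_complex C (tgt f)"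
    "\<And>n. cmp f n \<in> Arr C" "\<And>n. Dom C (cmp f n) = trm (src f) n" "\<And>n. Cod C (cmp f n) = trm (tgt f) n"
    "\<And>n. dif (tgt f) n \<cdot> cmp f n = cmp f (n + 1) \<cdot> dif (src f) n"
  shows "is_chain_map C f"
  using assms unfolding is_chain_map_def Hom_iff by blast

lemma chain_ident [simp]:
  "is_complex C X \<Longrightarrow> is_chain_map C \<lparr>src = X, tgt = X, cmp = (\<lambda>n. ident C (trm X n))\<rparr>"
  by (rule chain_mapI) auto

lemma chain_compose [simp]:
  "\<lbrakk>is_chain_map C f; is_chain_map C g; src g = tgt f; tgt g = Y; src f = X\<rbrakk>
   \<Longrightarrow> is_chain_map C \<lparr>src = X, tgt = Y, cmp = (\<lambda>n. cmp g n \<cdot> cmp f n)\<rparr>"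
  by (rule chain_mapI) auto

lemma chain_zero [simp]:
  "\<lbrakk>is_complex C X; is_complex C Y\<rbrakk>
   \<Longrightarrow> is_chain_map C \<lparr>src = X, tgt = Y, cmp = (\<lambda>n. Zero C (trm X n) (trm Y n))\<rparr>"
  by (rule chain_mapI) auto

lemma chain_add [simp]:
  "\<lbrakk>is_chain_map C f; is_chain_map C g; src f = X; tgt f = Y; src g = X; tgt g = Y\<rbrakk>
   \<Longrightarrow> is_chain_map C \<lparr>src = X, tgt = Y, cmp = (\<lambda>n. cmp f n \<boxplus> cmp g n)\<rparr>"
  by (rule chain_mapI) auto

lemma chain_neg:
  "is_chain_map C f \<Longrightarrow> is_chain_map C \<lparr>src = src f, tgt = tgt f, cmp = (\<lambda>n. Neg C (cmp f n))\<rparr>"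
  by (rule chain_mapI) auto

lemma Cpx_category: "category (Cpx C)"
  by unfold_locales (auto intro: chain_map_eqI)

lemma Cpx_preadditive: "preadditive_category (Cpx C)"
proof -
  interpret K: category "Cpx C" by (rule Cpx_category)
  show ?thesis
  proof (intro preadditive_category.intro preadditive_category_axioms.intro K.category_axioms)
    fix X Y assume "X \<in> Obj (Cpx C)" "Y \<in> Obj (Cpx C)"
    then have X [simp]: "is_complex C X" "is_complex C Y" by auto
    show "comm_group (Hom_group (Cpx C) X Y)"
    proof (rule comm_groupI)
      fix f assume "f \<in> carrier (Hom_group (Cpx C) X Y)"
      then have f: "is_chain_map C f" "src f = X" "tgt f = Y" by (auto simp: Hom_group_def)
      show "\<exists>g\<in>carrier (Hom_group (Cpx C) X Y). g \<otimes>\<^bsub>Hom_group (Cpx C) X Y\<^esub> f = \<one>\<^bsub>Hom_group (Cpx C) X Y\<^esub>"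
        using chain_neg[OF f(1)] f
        by (intro bexI[where x = "\<lparr>src = src f, tgt = tgt f, cmp = (\<lambda>n. Neg C (cmp f n))\<rparr>"])
          (auto simp: Hom_group_def)
    qed (auto simp: Hom_group_def intro!: chain_map_eqI add_assoc add_comm)
  qed (auto intro!: chain_map_eqI)
qed

end

section \<open>Degreewise split sequences\<close>

text \<open>
  The parameter \<open>k\<close> is determined by the splitting; it is kept separate so that it can be instantiated with the
  shape that is wanted in each application, such as \<open>\<eta> g\<close>.
\<close>
locale split_seq = additive_category B for B :: "('o, 'm) cat" (structure) +
  fixes Y E Z :: "('o, 'm) cochain" and i p :: "('o, 'm) chain_map" and r s k :: "int \<Rightarrow> 'm"
  assumes i_hom: "i \<in> Hom (Cpx B) Y E" and p_hom: "p \<in> Hom (Cpx B) E Z"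
    and r_hom: "r n \<in> Hom B (trm E n) (trm Y n)" and s_hom: "s n \<in> Hom B (trm Z n) (trm E n)"
    and p_s [simp]: "cmp p n \<cdot> s n = ident B (trm Z n)"
    and r_i [simp]: "r n \<cdot> cmp i n = ident B (trm Y n)"
    and p_i [simp]: "cmp p n \<cdot> cmp i n = Zero B (trm Y n) (trm Z n)"
    and r_s [simp]: "r n \<cdot> s n = Zero B (trm Z n) (trm Y n)"
    and split: "cmp i n \<cdot> r n \<boxplus> s n \<cdot> cmp p n = ident B (trm E n)"
    and cocycle: "r (n + 1) \<cdot> (dif E n \<cdot> s n) = k n"
begin

lemma typed [simp]:
  "is_chain_map B i" "src i = Y" "tgt i = E" "is_chain_map B p" "src p = E" "tgt p = Z"
  "r n \<in> Arr B" "Dom B (r n) = trm E n" "Cod B (r n) = trm Y n"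
  "s n \<in> Arr B" "Dom B (s n) = trm Z n" "Cod B (s n) = trm E n"
  using i_hom p_hom r_hom s_hom by (auto simp: Hom_iff)

lemma complexes [simp]: "is_complex B Y" "is_complex B E" "is_complex B Z"
  using chain_typed(1,2)[of i] chain_typed(1,2)[of p] by auto

lemma k_typed [simp]: "k n \<in> Arr B" "Dom B (k n) = trm Z n" "Cod B (k n) = trm Y (n + 1)"
  unfolding cocycle[symmetric] by simp_all

lemma split_comp [simp]:
  "\<lbrakk>x \<in> Arr B; Cod B x = trm Z n\<rbrakk> \<Longrightarrow> cmp p n \<cdot> (s n \<cdot> x) = x"
  "\<lbrakk>x \<in> Arr B; Cod B x = trm Y n\<rbrakk> \<Longrightarrow> r n \<cdot> (cmp i n \<cdot> x) = x"
  "\<lbrakk>x \<in> Arr B; Cod B x = trm Y n\<rbrakk> \<Longrightarrow> cmp p n \<cdot> (cmp i n \<cdot> x) = Zero B (Dom B x) (trm Z n)"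
  "\<lbrakk>x \<in> Arr B; Cod B x = trm Z n\<rbrakk> \<Longrightarrow> r n \<cdot> (s n \<cdot> x) = Zero B (Dom B x) (trm Y n)"
  using comp_rewrite[OF p_s, of x] comp_rewrite[OF r_i, of x] comp_rewrite[OF p_i, of x]
    comp_rewrite[OF r_s, of x] by simp_all

lemma split_left:
  assumes "x \<in> Arr B" "Cod B x = trm E n"
  shows "cmp i n \<cdot> (r n \<cdot> x) \<boxplus> s n \<cdot> (cmp p n \<cdot> x) = x"
proof -
  have "cmp i n \<cdot> (r n \<cdot> x) \<boxplus> s n \<cdot> (cmp p n \<cdot> x) = (cmp i n \<cdot> r n \<boxplus> s n \<cdot> cmp p n) \<cdot> x"
    using assms by simp
  also have "\<dots> = x" unfolding split using assms by simp
  finally show ?thesis .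
qed

lemma split_right:
  assumes "x \<in> Arr B" "Dom B x = trm E n"
  shows "x \<cdot> (cmp i n \<cdot> r n) \<boxplus> x \<cdot> (s n \<cdot> cmp p n) = x"
proof -
  have "x \<cdot> (cmp i n \<cdot> r n) \<boxplus> x \<cdot> (s n \<cdot> cmp p n) = x \<cdot> (cmp i n \<cdot> r n \<boxplus> s n \<cdot> cmp p n)"
    using assms by simp
  also have "\<dots> = x" unfolding split using assms by simp
  finally show ?thesis .
qed

lemma dif_p: "cmp p (n + 1) \<cdot> dif E n = dif Z n \<cdot> cmp p n"
  by simp

text \<open>
  The component of \<open>d s\<close> in \<open>Z\<close> is \<open>d\<close> because \<open>p\<close> is a chain map, and its component in \<open>Y\<close> is \<open>k\<close> by
  definition.  Differentials are moved to the right past chain maps and sections.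
\<close>
lemma dif_s [simp]: "dif E n \<cdot> s n = s (n + 1) \<cdot> dif Z n \<boxplus> cmp i (n + 1) \<cdot> k n"
proof -
  have *: "cmp p (n + 1) \<cdot> (dif E n \<cdot> s n) = dif Z n"
    using comp_rewrite[OF dif_p, of "s n" n] by (simp del: chain_comm)
  show ?thesis
    using split_left[of "dif E n \<cdot> s n" "n + 1", unfolded cocycle *] by (simp add: add_comm)
qed

lemma cocycle_comp:
  "\<lbrakk>x \<in> Arr B; Cod B x = trm Z n\<rbrakk> \<Longrightarrow> r (n + 1) \<cdot> (dif E n \<cdot> (s n \<cdot> x)) = k n \<cdot> x"
  using comp_rewrite[OF cocycle, of x n] by (simp del: dif_s)

text \<open>
  Dual to \<open>dif_s\<close>.  The differential moves to the left past \<open>r\<close>, since the opposite orientation would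
  need a subtraction.
\<close>
lemma r_dif [simp]:
  assumes "m = n + 1"
  shows "r m \<cdot> dif E n = dif Y n \<cdot> r n \<boxplus> k n \<cdot> cmp p n"
  using split_right[of "r m \<cdot> dif E n" n] assms by (simp add: cocycle_comp del: dif_s)

lemma dif_s_comp [simp]:
  assumes "x \<in> Arr B" "Cod B x = trm Z n"
  shows "dif E n \<cdot> (s n \<cdot> x) = s (n + 1) \<cdot> (dif Z n \<cdot> x) \<boxplus> cmp i (n + 1) \<cdot> (k n \<cdot> x)"
  using comp_rewrite[OF dif_s, of x] assms by simp

lemma r_dif_comp [simp]:
  assumes "m = n + 1" "x \<in> Arr B" "Cod B x = trm E n"
  shows "r m \<cdot> (dif E n \<cdot> x) = dif Y n \<cdot> (r n \<cdot> x) \<boxplus> k n \<cdot> (cmp p n \<cdot> x)"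
  using comp_rewrite[OF r_dif, of m n x] assms by simp

text \<open>
  If \<open>p f = 0\<close>, then \<open>f = i (r f)\<close>, and \<open>r f\<close> is a chain map because the defect \<open>k p\<close> of \<open>r\<close> vanishes on \<open>f\<close>.
  Cokernels are dual, with \<open>f s\<close>.
\<close>
lemma exact: "exact_pair (Cpx B) i p"
proof -
  have "is_kernel (Cpx B) i p"
    unfolding is_kernel_def
  proof (intro conjI ballI impI)
    fix f assume "f \<in> Arr (Cpx B)"
      "Cod (Cpx B) f = Dom (Cpx B) p \<and> p \<cdot>\<^bsub>Cpx B\<^esub> f = Zero (Cpx B) (Dom (Cpx B) f) (Cod (Cpx B) p)"
    then have f [simp]: "is_chain_map B f" "tgt f = E"
      and pf: "(\<lambda>n. cmp p n \<cdot> cmp f n) = (\<lambda>n. Zero B (trm (src f) n) (trm Z n))" by auto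
    have pf [simp]: "cmp p n \<cdot> cmp f n = Zero B (trm (src f) n) (trm Z n)" for n
      using fun_cong[OF pf] .
    have irf [simp]: "cmp i n \<cdot> (r n \<cdot> cmp f n) = cmp f n" for n
      using split_left[of "cmp f n" n] by simp
    have comm: "dif Y n \<cdot> (r n \<cdot> cmp f n) = r (n + 1) \<cdot> (cmp f (n + 1) \<cdot> dif (src f) n)" for n
      using r_dif_comp[of "n + 1" n "cmp f n"] by (simp del: r_dif_comp)
    show "\<exists>!u. u \<in> Hom (Cpx B) (Dom (Cpx B) f) (Dom (Cpx B) i) \<and> i \<cdot>\<^bsub>Cpx B\<^esub> u = f"
    proof (rule ex1I[where a = "\<lparr>src = src f, tgt = Y, cmp = (\<lambda>n. r n \<cdot> cmp f n)\<rparr>"])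
      fix u assume "u \<in> Hom (Cpx B) (Dom (Cpx B) f) (Dom (Cpx B) i) \<and> i \<cdot>\<^bsub>Cpx B\<^esub> u = f"
      then have u [simp]: "is_chain_map B u" "src u = src f" "tgt u = Y"
        and eq: "i \<cdot>\<^bsub>Cpx B\<^esub> u = f" by (simp_all del: Cpx_sel(6))
      have "cmp f n = cmp i n \<cdot> cmp u n" for n unfolding eq[symmetric] by simp
      then show "u = \<lparr>src = src f, tgt = Y, cmp = (\<lambda>n. r n \<cdot> cmp f n)\<rparr>"
        by (intro chain_map_eqI) auto
    qed (auto intro!: chain_mapI chain_map_eqI comm)
  qed (auto intro: chain_map_eqI)
  moreover have "is_cokernel (Cpx B) p i"
    unfolding is_cokernel_def
  proof (intro conjI ballI impI)
    fix f assume "f \<in> Arr (Cpx B)"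
      "Dom (Cpx B) f = Cod (Cpx B) i \<and> f \<cdot>\<^bsub>Cpx B\<^esub> i = Zero (Cpx B) (Dom (Cpx B) i) (Cod (Cpx B) f)"
    then have f [simp]: "is_chain_map B f" "src f = E"
      and fi: "(\<lambda>n. cmp f n \<cdot> cmp i n) = (\<lambda>n. Zero B (trm Y n) (trm (tgt f) n))" by auto
    have fi [simp]: "cmp f n \<cdot> cmp i n = Zero B (trm Y n) (trm (tgt f) n)" for n
      using fun_cong[OF fi] .
    have fi' [simp]: "cmp f n \<cdot> (cmp i n \<cdot> x) = Zero B (Dom B x) (trm (tgt f) n)"
      if "x \<in> Arr B" "Cod B x = trm Y n" for n x
      using comp_rewrite[OF fi, of x n] that by simp
    have fsp [simp]: "cmp f n \<cdot> (s n \<cdot> cmp p n) = cmp f n" for n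
      using split_right[of "cmp f n" n] by simp
    show "\<exists>!u. u \<in> Hom (Cpx B) (Cod (Cpx B) p) (Cod (Cpx B) f) \<and> u \<cdot>\<^bsub>Cpx B\<^esub> p = f"
    proof (rule ex1I[where a = "\<lparr>src = Z, tgt = tgt f, cmp = (\<lambda>n. cmp f n \<cdot> s n)\<rparr>"])
      fix u assume "u \<in> Hom (Cpx B) (Cod (Cpx B) p) (Cod (Cpx B) f) \<and> u \<cdot>\<^bsub>Cpx B\<^esub> p = f"
      then have u [simp]: "is_chain_map B u" "src u = Z" "tgt u = tgt f"
        and eq: "u \<cdot>\<^bsub>Cpx B\<^esub> p = f" by (simp_all del: Cpx_sel(6))
      have "cmp f n = cmp u n \<cdot> cmp p n" for n unfolding eq[symmetric] by simp
      then show "u = \<lparr>src = Z, tgt = tgt f, cmp = (\<lambda>n. cmp f n \<cdot> s n)\<rparr>"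
        by (intro chain_map_eqI) auto
    qed (auto intro!: chain_mapI chain_map_eqI)
  qed (auto intro: chain_map_eqI)
  ultimately show ?thesis by (simp add: exact_pair_def)
qed

end

lemma cpx_shift_sel [simp]:
  "trm (cpx_shift B X) n = trm X (n + 1)" "dif (cpx_shift B X) n = Neg B (dif X (n + 1))"
  by (simp_all add: cpx_shift_def)

lemma cone_sel [simp]:
  "trm (cone B f) n = bp_obj (cone_term B f n)"
  "src (cone_in B f) = tgt f" "tgt (cone_in B f) = cone B f"
  "src (cone_out B f) = cone B f" "tgt (cone_out B f) = cpx_shift B (src f)"
  "cmp (cone_in B f) n = bp_in2 (cone_term B f n)"
  "cmp (cone_out B f) n = bp_pr1 (cone_term B f n)"
  by (simp_all add: cone_def cone_in_def cone_out_def)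

text \<open>
  The inverse shift \<open>X[-1]\<close>.
\<close>
definition unshift :: "('o, 'm) cat \<Rightarrow> ('o, 'm) cochain \<Rightarrow> ('o, 'm) cochain" where
  "unshift B X = \<lparr>trm = (\<lambda>n. trm X (n - 1)), dif = (\<lambda>n. Neg B (dif X (n - 1)))\<rparr>"

lemma unshift_sel [simp]:
  "trm (unshift B X) n = trm X (n - 1)" "dif (unshift B X) n = Neg B (dif X (n - 1))"
  by (simp_all add: unshift_def)

context preadditive_category
begin

lemma is_complexI:
  assumes "\<And>n. trm X n \<in> Obj C" "\<And>n. dif X n \<in> Arr C" "\<And>n. Dom C (dif X n) = trm X n"
    "\<And>n. Cod C (dif X n) = trm X (n + 1)"
    "\<And>n. dif X (n + 1) \<cdot> dif X n = Zero C (trm X n) (trm X (n + 2))"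
  shows "is_complex C X"
  using assms unfolding is_complex_def Hom_iff by blast

lemma shift_complex [simp]: "is_complex C X \<Longrightarrow> is_complex C (cpx_shift C X)"
  by (rule is_complexI) (auto simp: add.commute)

lemma unshift_complex [simp]: "is_complex C X \<Longrightarrow> is_complex C (unshift C X)"
  by (rule is_complexI) auto

lemma shift_unshift [simp]: "is_complex C X \<Longrightarrow> cpx_shift C (unshift C X) = X"
  by (rule cochain.equality) (auto simp: cpx_shift_def)

end

context additive_category
begin

lemma dsum_biproduct: "\<lbrakk>A \<in> Obj C; D \<in> Obj C\<rbrakk> \<Longrightarrow> is_biproduct C A D (dsum C A D)"
  unfolding dsum_def by (rule someI_ex) (rule biproduct_exists)

text \<open>
  For the cone of \<open>f\<close>, the maps \<open>k\<close> are the components of \<open>f\<close>, reindexed by the shift of its source.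
\<close>
lemma cone_split_seq:
  assumes f: "is_chain_map C f"
  shows "split_seq C (tgt f) (cone C f) (cpx_shift C (src f)) (cone_in C f) (cone_out C f)
    (\<lambda>n. bp_pr2 (cone_term C f n)) (\<lambda>n. bp_in1 (cone_term C f n)) (\<lambda>n. cmp f (n + 1))"
proof -
  note f [simp]
  have bp: "is_biproduct C (trm (src f) (n + 1)) (trm (tgt f) n) (cone_term C f n)" for n
    unfolding cone_term_def by (rule dsum_biproduct) (use f in auto)
  note * = bp[unfolded is_biproduct_def Hom_iff]
  note [simp] = * [THEN conjunct1]
  have typed [simp]:
    "bp_in1 (cone_term C f n) \<in> Arr C" "Dom C (bp_in1 (cone_term C f n)) = trm (src f) (n + 1)"
    "Cod C (bp_in1 (cone_term C f n)) = bp_obj (cone_term C f n)"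
    "bp_in2 (cone_term C f n) \<in> Arr C" "Dom C (bp_in2 (cone_term C f n)) = trm (tgt f) n"
    "Cod C (bp_in2 (cone_term C f n)) = bp_obj (cone_term C f n)"
    "bp_pr1 (cone_term C f n) \<in> Arr C" "Cod C (bp_pr1 (cone_term C f n)) = trm (src f) (n + 1)"
    "Dom C (bp_pr1 (cone_term C f n)) = bp_obj (cone_term C f n)"
    "bp_pr2 (cone_term C f n) \<in> Arr C" "Cod C (bp_pr2 (cone_term C f n)) = trm (tgt f) n"
    "Dom C (bp_pr2 (cone_term C f n)) = bp_obj (cone_term C f n)" for n
    using *[of n] by blast+
  have eqs:
    "bp_pr1 (cone_term C f n) \<cdot> bp_in1 (cone_term C f n) = ident C (trm (src f) (n + 1))"
    "bp_pr2 (cone_term C f n) \<cdot> bp_in2 (cone_term C f n) = ident C (trm (tgt f) n)"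
    "bp_pr2 (cone_term C f n) \<cdot> bp_in1 (cone_term C f n) = Zero C (trm (src f) (n + 1)) (trm (tgt f) n)"
    "bp_pr1 (cone_term C f n) \<cdot> bp_in2 (cone_term C f n) = Zero C (trm (tgt f) n) (trm (src f) (n + 1))"
    for n
    using *[of n] by blast+
  note [simp] = eqs eqs[THEN comp_rewrite]
  have sum: "bp_in2 (cone_term C f n) \<cdot> bp_pr2 (cone_term C f n) \<boxplus>
      bp_in1 (cone_term C f n) \<cdot> bp_pr1 (cone_term C f n) = ident C (bp_obj (cone_term C f n))" for n
    using *[of n] by (subst add_comm) auto
  have dif: "dif (cone C f) n =
      Neg C (bp_in1 (cone_term C f (n + 1)) \<cdot> (dif (src f) (n + 1) \<cdot> bp_pr1 (cone_term C f n))) \<boxplus>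
      (bp_in2 (cone_term C f (n + 1)) \<cdot> (cmp f (n + 1) \<cdot> bp_pr1 (cone_term C f n)) \<boxplus>
       bp_in2 (cone_term C f (n + 1)) \<cdot> (dif (tgt f) n \<cdot> bp_pr2 (cone_term C f n)))" for n
    by (simp add: cone_def matrix_def)
  have cx: "is_complex C (cone C f)"
    by (rule is_complexI) (auto simp: dif)
  show ?thesis
  proof unfold_locales
    show "cone_in C f \<in> Hom (Cpx C) (tgt f) (cone C f)"
      "cone_out C f \<in> Hom (Cpx C) (cone C f) (cpx_shift C (src f))"
      using cx by (auto intro!: chain_mapI simp: dif)
  qed (auto simp: dif Hom_iff sum)
qed

text \<open>
  Maps \<open>k\<close> that anticommute with the differentials form a chain map from \<open>Z[-1]\<close> to \<open>Y\<close>, since the shift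
  changes the sign of the differential.  Its cone realises \<open>k\<close>.
\<close>
lemma extension_exists:
  assumes Y: "is_complex C Y" and Z: "is_complex C Z"
    and k: "\<And>n. k n \<in> Arr C" "\<And>n. Dom C (k n) = trm Z n" "\<And>n. Cod C (k n) = trm Y (n + 1)"
    and closed: "\<And>n. dif Y (n + 1) \<cdot> k n \<boxplus> k (n + 1) \<cdot> dif Z n = Zero C (trm Z n) (trm Y (n + 2))"
  defines "f \<equiv> \<lparr>src = unshift C Z, tgt = Y, cmp = (\<lambda>n. k (n - 1))\<rparr>"
  shows "is_chain_map C f"
    and "\<exists>r s. split_seq C Y (cone C f) Z (cone_in C f) (cone_out C f) r s k"
proof -
  note [simp] = Y Z k
  have comm: "dif Y n \<cdot> k (n - 1) = Neg C (k n \<cdot> dif Z (n - 1))" for n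
    using closed[of "n - 1"]
    by (intro neg_eqI[symmetric, where A = "trm Z (n - 1)" and B = "trm Y (n + 1)"])
      (auto simp: add_comm add.commute)
  show f: "is_chain_map C f"
    by (rule chain_mapI) (auto simp: f_def comm)
  show "\<exists>r s. split_seq C Y (cone C f) Z (cone_in C f) (cone_out C f) r s k"
    using cone_split_seq[OF f] by (force simp: f_def)
qed

end

text \<open>
  The map of middle terms that is diagonal, with entries \<open>u\<close> and \<open>w\<close>, with respect to the two splittings.
\<close>
definition split_map :: "('o, 'm) cat \<Rightarrow> ('o, 'm) chain_map \<Rightarrow> (int \<Rightarrow> 'm) \<Rightarrow> (int \<Rightarrow> 'm)
    \<Rightarrow> ('o, 'm) chain_map \<Rightarrow> ('o, 'm) chain_map \<Rightarrow> ('o, 'm) chain_map \<Rightarrow> ('o, 'm) chain_map" where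
  "split_map B p r s' i' u w = \<lparr>src = src p, tgt = tgt i',
     cmp = (\<lambda>n. cmp i' n \<cdot>\<^bsub>B\<^esub> (cmp u n \<cdot>\<^bsub>B\<^esub> r n) \<boxplus>\<^bsub>B\<^esub> s' n \<cdot>\<^bsub>B\<^esub> (cmp w n \<cdot>\<^bsub>B\<^esub> cmp p n))\<rparr>"

lemma split_map_sel [simp]:
  "src (split_map B p r s' i' u w) = src p" "tgt (split_map B p r s' i' u w) = tgt i'"
  "cmp (split_map B p r s' i' u w) n =
     cmp i' n \<cdot>\<^bsub>B\<^esub> (cmp u n \<cdot>\<^bsub>B\<^esub> r n) \<boxplus>\<^bsub>B\<^esub> s' n \<cdot>\<^bsub>B\<^esub> (cmp w n \<cdot>\<^bsub>B\<^esub> cmp p n)"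
  by (simp_all add: split_map_def)

context additive_category
begin

text \<open>
  The condition \<open>u k = k' w\<close> says exactly that the defects of the two splittings agree.
\<close>
lemma split_map_chain:
  assumes "split_seq C Y E Z i p r s k" and "split_seq C Y' E' Z' i' p' r' s' k'"
    and u [simp]: "is_chain_map C u" "src u = Y" "tgt u = Y'"
    and w [simp]: "is_chain_map C w" "src w = Z" "tgt w = Z'"
    and uk: "\<And>n. cmp u (n + 1) \<cdot> k n = k' n \<cdot> cmp w n"
  shows "is_chain_map C (split_map C p r s' i' u w)"
proof -
  interpret S: split_seq C Y E Z i p r s k by fact
  interpret S': split_seq C Y' E' Z' i' p' r' s' k' by fact
  have [simp]: "k' n \<cdot> (cmp w n \<cdot> cmp p n) = cmp u (n + 1) \<cdot> (k n \<cdot> cmp p n)" for n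
    using comp_rewrite[OF uk[symmetric], of "cmp p n" n] by simp
  show ?thesis
    by (rule chain_mapI) (auto simp: add_ac)
qed

text \<open>
  By \<open>split_map_chain\<close> with identities, \<open>k\<close> determines the sequence up to isomorphism.
\<close>
lemma split_seq_iso:
  assumes "split_seq C Y E Z i p r s k" and "split_seq C Y E' Z i' p' r' s' k"
  shows "pair_iso (Cpx C) (i, p) (i', p')"
proof -
  interpret S: split_seq C Y E Z i p r s k by fact
  interpret S': split_seq C Y E' Z i' p' r' s' k by fact
  define b b' where "b = split_map C p r s' i' (ident (Cpx C) Y) (ident (Cpx C) Z)"
    and "b' = split_map C p' r' s i (ident (Cpx C) Y) (ident (Cpx C) Z)"
  have b: "is_chain_map C b" "is_chain_map C b'"
    unfolding b_def b'_def
    by (rule split_map_chain[OF S.split_seq_axioms S'.split_seq_axioms]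
        split_map_chain[OF S'.split_seq_axioms S.split_seq_axioms]; simp)+
  have id: "iso_arr (Cpx C) (ident (Cpx C) X)" if "is_complex C X" for X
    using that unfolding iso_arr_def
    by (auto intro!: bexI[where x = "ident (Cpx C) X"])
  have "iso_arr (Cpx C) b"
    unfolding iso_arr_def
    using b S.split S'.split
    by (auto intro!: bexI[where x = b'] chain_map_eqI simp: b_def b'_def)
  then show ?thesis
    unfolding pair_iso_def prod.case using b id[of Y] id[of Z]
    by (intro bexI[where x = "ident (Cpx C) Y"] bexI[where x = "ident (Cpx C) Z"] bexI[where x = b])
      (auto simp: b_def intro!: chain_map_eqI)
qed

text \<open>
  Pulling back along \<open>f\<close> replaces \<open>k\<close> by \<open>k f\<close>.  Maps \<open>x\<close> and \<open>y\<close> into \<open>E\<close> and \<open>W\<close> with the same image in \<open>Z\<close>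
  induce \<open>i' r x + s' y\<close>.
\<close>
lemma split_pullback:
  assumes "split_seq C Y E Z i p r s k" and "split_seq C Y E' W i' p' r' s' k'"
    and f [simp]: "is_chain_map C f" "src f = W" "tgt f = Z"
    and k': "\<And>n. k' n = k n \<cdot> cmp f n"
  shows "is_pullback (Cpx C) p f p' (split_map C p' r' s i (ident (Cpx C) Y) f)"
    (is "is_pullback _ _ _ _ ?m")
proof -
  interpret S: split_seq C Y E Z i p r s k by fact
  interpret S': split_seq C Y E' W i' p' r' s' k' by fact
  note k' [simp]
  have m: "is_chain_map C ?m"
    by (rule split_map_chain[OF S'.split_seq_axioms S.split_seq_axioms]) auto
  show ?thesis
    unfolding is_pullback_def
  proof (intro conjI ballI impI)
    fix V x y assume "V \<in> Obj (Cpx C)" "x \<in> Hom (Cpx C) V (Dom (Cpx C) p)"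
      "y \<in> Hom (Cpx C) V (Dom (Cpx C) f)" and eq: "p \<cdot>\<^bsub>Cpx C\<^esub> x = f \<cdot>\<^bsub>Cpx C\<^esub> y"
    then have x [simp]: "is_complex C V" "is_chain_map C x" "src x = V" "tgt x = E"
      "is_chain_map C y" "src y = V" "tgt y = W" by auto
    have eq [simp]: "cmp p n \<cdot> cmp x n = cmp f n \<cdot> cmp y n" for n
      using arg_cong[OF eq, of "\<lambda>h. cmp h n"] by simp
    define v where "v = \<lparr>src = V, tgt = E', cmp = (\<lambda>n. cmp i' n \<cdot> (r n \<cdot> cmp x n) \<boxplus> s' n \<cdot> cmp y n)\<rparr>"
    have rd: "r (n + 1) \<cdot> (cmp x (n + 1) \<cdot> dif V n) = dif Y n \<cdot> (r n \<cdot> cmp x n) \<boxplus> k n \<cdot> (cmp f n \<cdot> cmp y n)" for n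
      using S.r_dif_comp[of "n + 1" n "cmp x n"] by (simp del: S.r_dif_comp)
    have v: "is_chain_map C v"
      by (rule chain_mapI) (auto simp: v_def rd add_ac)
    show "\<exists>!v. v \<in> Hom (Cpx C) V (Dom (Cpx C) p') \<and> ?m \<cdot>\<^bsub>Cpx C\<^esub> v = x \<and> p' \<cdot>\<^bsub>Cpx C\<^esub> v = y"
    proof (rule ex1I[where a = v])
      have "cmp i n \<cdot> (r n \<cdot> cmp x n) \<boxplus> s n \<cdot> (cmp f n \<cdot> cmp y n) = cmp x n" for n
        using S.split_left[of "cmp x n" n] by simp
      then show "v \<in> Hom (Cpx C) V (Dom (Cpx C) p') \<and> ?m \<cdot>\<^bsub>Cpx C\<^esub> v = x \<and> p' \<cdot>\<^bsub>Cpx C\<^esub> v = y"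
        using v by (auto intro!: chain_map_eqI simp: v_def)
    next
      fix z assume "z \<in> Hom (Cpx C) V (Dom (Cpx C) p') \<and> ?m \<cdot>\<^bsub>Cpx C\<^esub> z = x \<and> p' \<cdot>\<^bsub>Cpx C\<^esub> z = y"
      then have z [simp]: "is_chain_map C z" "src z = V" "tgt z = E'"
        and eqs: "?m \<cdot>\<^bsub>Cpx C\<^esub> z = x" "p' \<cdot>\<^bsub>Cpx C\<^esub> z = y" by (simp_all del: Cpx_sel(6))
      have [simp]: "cmp p' n \<cdot> cmp z n = cmp y n" for n
        using arg_cong[OF eqs(2), of "\<lambda>h. cmp h n"] by simp
      have "cmp i n \<cdot> (r' n \<cdot> cmp z n) \<boxplus> s n \<cdot> (cmp f n \<cdot> cmp y n) = cmp x n" for n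
        using arg_cong[OF eqs(1), of "\<lambda>h. cmp h n"] by simp
      then have "r n \<cdot> cmp x n = r n \<cdot> (cmp i n \<cdot> (r' n \<cdot> cmp z n) \<boxplus> s n \<cdot> (cmp f n \<cdot> cmp y n))" for n
        by metis
      then have [simp]: "r n \<cdot> cmp x n = r' n \<cdot> cmp z n" for n by simp
      show "z = v"
        using S'.split_left[of "cmp z n" n for n]
        by (intro chain_map_eqI) (auto simp: v_def)
    qed
  qed (use m in \<open>auto intro!: chain_map_eqI\<close>)
qed

text \<open>
  Pushing out along \<open>u\<close> replaces \<open>k\<close> by \<open>u k\<close>.  Maps \<open>x\<close> and \<open>y\<close> out of \<open>E\<close> and \<open>Y'\<close> that agree on \<open>Y\<close> induce
  \<open>y r' + x s p'\<close>.
\<close>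
lemma split_pushout:
  assumes "split_seq C Y E Z i p r s k" and "split_seq C Y' E' Z i' p' r' s' k'"
    and u [simp]: "is_chain_map C u" "src u = Y" "tgt u = Y'"
    and k': "\<And>n. k' n = cmp u (n + 1) \<cdot> k n"
  shows "is_pushout (Cpx C) i u i' (split_map C p r s' i' u (ident (Cpx C) Z))"
    (is "is_pushout _ _ _ _ ?m")
proof -
  interpret S: split_seq C Y E Z i p r s k by fact
  interpret S': split_seq C Y' E' Z i' p' r' s' k' by fact
  note k' [simp]
  have m: "is_chain_map C ?m"
    by (rule split_map_chain[OF S.split_seq_axioms S'.split_seq_axioms]) auto
  show ?thesis
    unfolding is_pushout_def
  proof (intro conjI ballI impI)
    fix V x y assume "V \<in> Obj (Cpx C)" "x \<in> Hom (Cpx C) (Cod (Cpx C) i) V"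
      "y \<in> Hom (Cpx C) (Cod (Cpx C) u) V" and eq: "x \<cdot>\<^bsub>Cpx C\<^esub> i = y \<cdot>\<^bsub>Cpx C\<^esub> u"
    then have x [simp]: "is_complex C V" "is_chain_map C x" "src x = E" "tgt x = V"
      "is_chain_map C y" "src y = Y'" "tgt y = V" by auto
    have eq [simp]: "cmp x n \<cdot> cmp i n = cmp y n \<cdot> cmp u n" for n
      using arg_cong[OF eq, of "\<lambda>h. cmp h n"] by simp
    note [simp] = eq[THEN comp_rewrite]
    define v where "v = \<lparr>src = E', tgt = V, cmp = (\<lambda>n. cmp y n \<cdot> r' n \<boxplus> cmp x n \<cdot> (s n \<cdot> cmp p' n))\<rparr>"
    have v: "is_chain_map C v"
      by (rule chain_mapI) (auto simp: v_def add_ac)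
    show "\<exists>!v. v \<in> Hom (Cpx C) (Cod (Cpx C) i') V \<and> v \<cdot>\<^bsub>Cpx C\<^esub> ?m = x \<and> v \<cdot>\<^bsub>Cpx C\<^esub> i' = y"
    proof (rule ex1I[where a = v])
      have "cmp y n \<cdot> (cmp u n \<cdot> r n) \<boxplus> cmp x n \<cdot> (s n \<cdot> cmp p n) = cmp x n" for n
        using S.split_right[of "cmp x n" n] by simp
      then show "v \<in> Hom (Cpx C) (Cod (Cpx C) i') V \<and> v \<cdot>\<^bsub>Cpx C\<^esub> ?m = x \<and> v \<cdot>\<^bsub>Cpx C\<^esub> i' = y"
        using v by (auto intro!: chain_map_eqI simp: v_def)
    next
      fix z assume "z \<in> Hom (Cpx C) (Cod (Cpx C) i') V \<and> z \<cdot>\<^bsub>Cpx C\<^esub> ?m = x \<and> z \<cdot>\<^bsub>Cpx C\<^esub> i' = y"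
      then have z [simp]: "is_chain_map C z" "src z = E'" "tgt z = V"
        and eqs: "z \<cdot>\<^bsub>Cpx C\<^esub> ?m = x" "z \<cdot>\<^bsub>Cpx C\<^esub> i' = y" by (simp_all del: Cpx_sel(6))
      have zi: "cmp z n \<cdot> cmp i' n = cmp y n" for n
        using arg_cong[OF eqs(2), of "\<lambda>h. cmp h n"] by simp
      note [simp] = zi zi[THEN comp_rewrite]
      have "cmp y n \<cdot> (cmp u n \<cdot> r n) \<boxplus> cmp z n \<cdot> (s' n \<cdot> cmp p n) = cmp x n" for n
        using arg_cong[OF eqs(1), of "\<lambda>h. cmp h n"] by simp
      then have "cmp x n \<cdot> s n = (cmp y n \<cdot> (cmp u n \<cdot> r n) \<boxplus> cmp z n \<cdot> (s' n \<cdot> cmp p n)) \<cdot> s n" for n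
        by metis
      then have xs: "cmp x n \<cdot> s n = cmp z n \<cdot> s' n" for n by simp
      note [simp] = xs xs[THEN comp_rewrite]
      show "z = v"
        using S'.split_right[of "cmp z n" n for n]
        by (intro chain_map_eqI) (auto simp: v_def)
    qed
  qed (use m in \<open>auto intro!: chain_map_eqI\<close>)
qed

lemma split_seq_transport:
  assumes S: "split_seq C Y E Z i p r s k"
    and a: "a \<in> Hom (Cpx C) Y' Y" "a' \<in> Hom (Cpx C) Y Y'"
      "a' \<cdot>\<^bsub>Cpx C\<^esub> a = ident (Cpx C) Y'" "a \<cdot>\<^bsub>Cpx C\<^esub> a' = ident (Cpx C) Y"
    and b: "b \<in> Hom (Cpx C) E' E" "b' \<in> Hom (Cpx C) E E'"
      "b' \<cdot>\<^bsub>Cpx C\<^esub> b = ident (Cpx C) E'" "b \<cdot>\<^bsub>Cpx C\<^esub> b' = ident (Cpx C) E"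
    and c: "c \<in> Hom (Cpx C) Z' Z" "c' \<in> Hom (Cpx C) Z Z'"
      "c' \<cdot>\<^bsub>Cpx C\<^esub> c = ident (Cpx C) Z'" "c \<cdot>\<^bsub>Cpx C\<^esub> c' = ident (Cpx C) Z"
    and i': "i' \<in> Hom (Cpx C) Y' E'" "b \<cdot>\<^bsub>Cpx C\<^esub> i' = i \<cdot>\<^bsub>Cpx C\<^esub> a"
    and p': "p' \<in> Hom (Cpx C) E' Z'" "c \<cdot>\<^bsub>Cpx C\<^esub> p' = p \<cdot>\<^bsub>Cpx C\<^esub> b"
  shows "split_seq C Y' E' Z' i' p' (\<lambda>n. cmp a' n \<cdot> (r n \<cdot> cmp b n)) (\<lambda>n. cmp b' n \<cdot> (s n \<cdot> cmp c n))
    (\<lambda>n. cmp a' (n + 1) \<cdot> (k n \<cdot> cmp c n))"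
proof -
  interpret S: split_seq C Y E Z i p r s k by fact
  have [simp]: "is_chain_map C a" "src a = Y'" "tgt a = Y" "is_chain_map C a'" "src a' = Y" "tgt a' = Y'"
    "is_chain_map C b" "src b = E'" "tgt b = E" "is_chain_map C b'" "src b' = E" "tgt b' = E'"
    "is_chain_map C c" "src c = Z'" "tgt c = Z" "is_chain_map C c'" "src c' = Z" "tgt c' = Z'"
    "is_chain_map C i'" "src i' = Y'" "tgt i' = E'" "is_chain_map C p'" "src p' = E'" "tgt p' = Z'"
    using a(1,2) b(1,2) c(1,2) i'(1) p'(1) by auto
  have [simp]: "is_complex C Y'" "is_complex C E'" "is_complex C Z'"
    using chain_typed(1)[of i'] chain_typed(1,2)[of p'] by auto
  have inv: "cmp a' n \<cdot> cmp a n = ident C (trm Y' n)" "cmp a n \<cdot> cmp a' n = ident C (trm Y n)"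
    "cmp b' n \<cdot> cmp b n = ident C (trm E' n)" "cmp b n \<cdot> cmp b' n = ident C (trm E n)"
    "cmp c' n \<cdot> cmp c n = ident C (trm Z' n)" "cmp c n \<cdot> cmp c' n = ident C (trm Z n)" for n
    using a(3,4)[THEN arg_cong, of "\<lambda>h. cmp h n"] b(3,4)[THEN arg_cong, of "\<lambda>h. cmp h n"]
      c(3,4)[THEN arg_cong, of "\<lambda>h. cmp h n"] by simp_all
  note [simp] = inv inv[THEN comp_rewrite]
  have "cmp b n \<cdot> cmp i' n = cmp i n \<cdot> cmp a n" for n
    using i'(2)[THEN arg_cong, of "\<lambda>h. cmp h n"] by simp
  then have "cmp b' n \<cdot> (cmp b n \<cdot> cmp i' n) = cmp b' n \<cdot> (cmp i n \<cdot> cmp a n)" for n by metis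
  then have i'_eq: "cmp i' n = cmp b' n \<cdot> (cmp i n \<cdot> cmp a n)" for n by simp
  have "cmp c n \<cdot> cmp p' n = cmp p n \<cdot> cmp b n" for n
    using p'(2)[THEN arg_cong, of "\<lambda>h. cmp h n"] by simp
  then have "cmp c' n \<cdot> (cmp c n \<cdot> cmp p' n) = cmp c' n \<cdot> (cmp p n \<cdot> cmp b n)" for n by metis
  then have p'_eq: "cmp p' n = cmp c' n \<cdot> (cmp p n \<cdot> cmp b n)" for n by simp
  have "cmp b' n \<cdot> (cmp i n \<cdot> (r n \<cdot> cmp b n)) \<boxplus> cmp b' n \<cdot> (s n \<cdot> (cmp p n \<cdot> cmp b n)) =
      cmp b' n \<cdot> (cmp i n \<cdot> (r n \<cdot> cmp b n) \<boxplus> s n \<cdot> (cmp p n \<cdot> cmp b n))" for n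
    by simp
  then have split: "cmp b' n \<cdot> (cmp i n \<cdot> (r n \<cdot> cmp b n)) \<boxplus> cmp b' n \<cdot> (s n \<cdot> (cmp p n \<cdot> cmp b n)) =
      ident C (trm E' n)" for n
    by (simp only: S.split_left chain_typed S.typed \<open>tgt b = E\<close> \<open>is_chain_map C b\<close> inv)
  show ?thesis
  proof unfold_locales
    show "i' \<in> Hom (Cpx C) Y' E'" "p' \<in> Hom (Cpx C) E' Z'" by fact+
  qed (simp_all add: Hom_iff i'_eq p'_eq split)
qed

end

section \<open>Complexes form an additive category\<close>

context additive_category
begin

text \<open>
  The direct sum of two complexes is their extension with \<open>k = 0\<close>, whose splitting consists of chain maps.
\<close>
lemma Cpx_additive: "additive_category (Cpx C)"
proof -
  interpret K: preadditive_category "Cpx C" by (rule Cpx_preadditive)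
  show ?thesis
  proof
    obtain Q where Q: "zero_object C Q" using zero_object_exists by blast
    then have Q_obj [simp]: "Q \<in> Obj C" by (simp add: zero_object_def)
    define Z where "Z = \<lparr>trm = (\<lambda>n::int. Q), dif = (\<lambda>n. Zero C Q Q)\<rparr>"
    have Z: "is_complex C Z"
      by (rule is_complexI) (auto simp: Z_def)
    have into_zero: "f = Zero C A Q" if "f \<in> Hom C A Q" "A \<in> Obj C" for f A
      using that Q unfolding zero_object_def by (metis Hom_iff Q_obj zero_typed)
    have out_of_zero: "f = Zero C Q A" if "f \<in> Hom C Q A" "A \<in> Obj C" for f A
      using that Q unfolding zero_object_def by (metis Hom_iff Q_obj zero_typed)
    have "zero_object (Cpx C) Z"
      unfolding zero_object_def
    proof (intro conjI ballI)
      fix A assume "A \<in> Obj (Cpx C)"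
      then have A [simp]: "is_complex C A" by simp
      show "\<exists>!f. f \<in> Hom (Cpx C) A Z"
      proof (rule ex1I[where a = "Zero (Cpx C) A Z"])
        fix f assume "f \<in> Hom (Cpx C) A Z"
        then have f: "is_chain_map C f" "src f = A" "tgt f = Z" by auto
        then have "cmp f n = Zero C (trm A n) Q" for n
          by (intro into_zero) (auto simp: Hom_iff Z_def)
        then show "f = Zero (Cpx C) A Z" using f by (intro chain_map_eqI) (auto simp: Z_def)
      qed (use Z in auto)
      show "\<exists>!f. f \<in> Hom (Cpx C) Z A"
      proof (rule ex1I[where a = "Zero (Cpx C) Z A"])
        fix f assume "f \<in> Hom (Cpx C) Z A"
        then have f: "is_chain_map C f" "src f = Z" "tgt f = A" by auto
        then have "cmp f n = Zero C Q (trm A n)" for n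
          by (intro out_of_zero) (auto simp: Hom_iff Z_def)
        then show "f = Zero (Cpx C) Z A" using f by (intro chain_map_eqI) (auto simp: Z_def)
      qed (use Z in auto)
    qed (use Z in auto)
    then show "\<exists>Z. zero_object (Cpx C) Z" by blast
  next
    fix Z Y assume "Z \<in> Obj (Cpx C)" "Y \<in> Obj (Cpx C)"
    then have [simp]: "is_complex C Z" "is_complex C Y" by auto
    obtain E i p r s where "split_seq C Y E Z i p r s (\<lambda>n. Zero C (trm Z n) (trm Y (n + 1)))"
      using extension_exists(2)[of Y Z "\<lambda>n. Zero C (trm Z n) (trm Y (n + 1))"] by auto
    then interpret S: split_seq C Y E Z i p r s "\<lambda>n. Zero C (trm Z n) (trm Y (n + 1))" .
    have s: "is_chain_map C \<lparr>src = Z, tgt = E, cmp = s\<rparr>" and r: "is_chain_map C \<lparr>src = E, tgt = Y, cmp = r\<rparr>"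
      by (rule chain_mapI; simp)+
    have "is_biproduct (Cpx C) Z Y \<lparr>bp_obj = E, bp_in1 = \<lparr>src = Z, tgt = E, cmp = s\<rparr>, bp_in2 = i,
        bp_pr1 = p, bp_pr2 = \<lparr>src = E, tgt = Y, cmp = r\<rparr>\<rparr>"
      using s r S.split
      by (auto simp: is_biproduct_def add_comm[of "s n \<cdot> cmp p n" "cmp i n \<cdot> r n" for n])
    then show "\<exists>S. is_biproduct (Cpx C) Z Y S" by blast
  qed
qed

end

section \<open>The twist and the transformation to the identity\<close>

lemma (in category) functor_typed:
  assumes "is_functor C D F" "f \<in> Arr C"
  shows "on_arr F f \<in> Hom D (on_obj F (Dom C f)) (on_obj F (Cod C f))"
  using assms(1)[unfolded is_functor_def, THEN conjunct2, THEN conjunct1, rule_format,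
      of "Dom C f" "Cod C f" f] assms(2)
  by (simp add: Hom_def)

locale additive_endofunctor = preadditive_category B for B :: "('o, 'm) cat" (structure) +
  fixes F :: "('o, 'm, 'o, 'm) fctr"
  assumes additive: "additive_functor B B F"
begin

lemma on_obj_typed [simp]: "A \<in> Obj B \<Longrightarrow> on_obj F A \<in> Obj B"
  using additive by (auto simp: additive_functor_def is_functor_def)

lemma on_arr_typed [simp]:
  assumes "f \<in> Arr B"
  shows "on_arr F f \<in> Arr B" "Dom B (on_arr F f) = on_obj F (Dom B f)" "Cod B (on_arr F f) = on_obj F (Cod B f)"
proof -
  have "on_arr F f \<in> Hom B (on_obj F (Dom B f)) (on_obj F (Cod B f))"
    using additive assms by (intro functor_typed) (auto simp: additive_functor_def)
  then show "on_arr F f \<in> Arr B" "Dom B (on_arr F f) = on_obj F (Dom B f)"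
    "Cod B (on_arr F f) = on_obj F (Cod B f)" by (auto simp: Hom_iff)
qed

lemma on_arr_ident [simp]: "A \<in> Obj B \<Longrightarrow> on_arr F (ident B A) = ident B (on_obj F A)"
  using additive by (auto simp: additive_functor_def is_functor_def)

lemma on_arr_comp [simp]:
  "\<lbrakk>f \<in> Arr B; g \<in> Arr B; Dom B g = Cod B f\<rbrakk> \<Longrightarrow> on_arr F (g \<cdot> f) = on_arr F g \<cdot> on_arr F f"
  using additive unfolding additive_functor_def is_functor_def by blast

lemma on_arr_add [simp]:
  "\<lbrakk>f \<in> Arr B; g \<in> Arr B; Dom B g = Dom B f; Cod B g = Cod B f\<rbrakk>
   \<Longrightarrow> on_arr F (f \<boxplus> g) = on_arr F f \<boxplus> on_arr F g"
  using additive[unfolded additive_functor_def, THEN conjunct2, rule_format, of "Dom B f" "Cod B f" f g]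
  by (simp add: Hom_iff)

lemma on_arr_zero [simp]:
  assumes "A \<in> Obj B" "D \<in> Obj B"
  shows "on_arr F (Zero B A D) = Zero B (on_obj F A) (on_obj F D)"
proof (rule add_cancel)
  have "on_arr F (Zero B A D) \<boxplus> on_arr F (Zero B A D) = on_arr F (Zero B A D \<boxplus> Zero B A D)"
    using assms by (intro on_arr_add[symmetric]) auto
  then show "on_arr F (Zero B A D) \<boxplus> on_arr F (Zero B A D) =
      on_arr F (Zero B A D) \<boxplus> Zero B (on_obj F A) (on_obj F D)"
    using assms by simp
qed (use assms in auto)

lemma on_arr_neg [simp]: "f \<in> Arr B \<Longrightarrow> on_arr F (Neg B f) = Neg B (on_arr F f)"
proof -
  assume f: "f \<in> Arr B"
  have "on_arr F f \<boxplus> on_arr F (Neg B f) = on_arr F (f \<boxplus> Neg B f)"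
    using f by (intro on_arr_add[symmetric]) auto
  then show ?thesis
    using f by (intro neg_eqI[symmetric, where A = "on_obj F (Dom B f)" and B = "on_obj F (Cod B f)"]) auto
qed

text \<open>
  Carries rewrite rules over to their images under \<open>F\<close>.
\<close>
lemma on_arr_rewrite:
  assumes "a \<cdot> b = c" "a \<in> Arr B" "b \<in> Arr B" "Dom B a = Cod B b"
  shows "on_arr F a \<cdot> on_arr F b = on_arr F c"
    and "\<lbrakk>x \<in> Arr B; Cod B x = on_obj F (Dom B b)\<rbrakk> \<Longrightarrow> on_arr F a \<cdot> (on_arr F b \<cdot> x) = on_arr F c \<cdot> x"
proof -
  show *: "on_arr F a \<cdot> on_arr F b = on_arr F c" using assms on_arr_comp by metis
  show "\<lbrakk>x \<in> Arr B; Cod B x = on_obj F (Dom B b)\<rbrakk> \<Longrightarrow> on_arr F a \<cdot> (on_arr F b \<cdot> x) = on_arr F c \<cdot> x"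
    using comp_rewrite[OF *, of x] assms by simp
qed

lemma on_arr_dif_dif [simp]:
  assumes "is_complex B X" "m = n + 1"
  shows "on_arr F (dif X m) \<cdot> on_arr F (dif X n) = Zero B (on_obj F (trm X n)) (on_obj F (trm X (n + 2)))"
  using on_arr_rewrite(1)[OF dif_dif[OF assms]] assms by simp

lemma on_arr_chain_comm [simp]:
  assumes "is_chain_map B f" "tgt f = Y"
  shows "on_arr F (dif Y n) \<cdot> on_arr F (cmp f n) = on_arr F (cmp f (n + 1)) \<cdot> on_arr F (dif (src f) n)"
    "\<lbrakk>x \<in> Arr B; Cod B x = on_obj F (trm (src f) n)\<rbrakk> \<Longrightarrow>
      on_arr F (dif Y n) \<cdot> (on_arr F (cmp f n) \<cdot> x) = on_arr F (cmp f (n + 1)) \<cdot> (on_arr F (dif (src f) n) \<cdot> x)"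
  using on_arr_rewrite(1)[OF chain_comm[OF assms, of n]] on_arr_rewrite(2)[OF chain_comm[OF assms, of n], of x] assms by auto

lemma cpx_fctr_sel [simp]:
  "trm (on_obj (cpx_fctr F) X) n = on_obj F (trm X n)"
  "dif (on_obj (cpx_fctr F) X) n = on_arr F (dif X n)"
  by (simp_all add: cpx_fctr_def Let_def)

lemma cpx_fctr_complex [simp]: "is_complex B X \<Longrightarrow> is_complex B (on_obj (cpx_fctr F) X)"
  by (rule is_complexI) auto

end

text \<open>
  Here \<open>T\<close> is \<open>(1)\<close> and \<open>U\<close> is its inverse \<open>(-1)\<close>.
\<close>
locale eta_setting = additive_category B for B :: "('o, 'm) cat" (structure) +
  fixes T U :: "('o, 'm, 'o, 'm) fctr" and \<eta> :: "'o \<Rightarrow> 'm"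
  assumes T_additive: "additive_functor B B T"
    and U_functor: "is_functor B B U"
    and U_T_obj [simp]: "A \<in> Obj B \<Longrightarrow> on_obj U (on_obj T A) = A"
    and T_U_obj [simp]: "A \<in> Obj B \<Longrightarrow> on_obj T (on_obj U A) = A"
    and U_T_arr [simp]: "f \<in> Arr B \<Longrightarrow> on_arr U (on_arr T f) = f"
    and T_U_arr [simp]: "f \<in> Arr B \<Longrightarrow> on_arr T (on_arr U f) = f"
    and \<eta>_natural: "natural_transformation B B T id_fctr \<eta>"
    and \<eta>_T: "X \<in> Obj B \<Longrightarrow> \<eta> (on_obj T X) = on_arr T (\<eta> X)"
begin

sublocale T: additive_endofunctor B T
  by unfold_locales (rule T_additive)

text \<open>
  The inverse of a bijective additive functor is additive.
\<close>
sublocale U: additive_endofunctor B U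
proof
  have ty: "on_arr U f \<in> Arr B \<and> Dom B (on_arr U f) = on_obj U (Dom B f) \<and> Cod B (on_arr U f) = on_obj U (Cod B f)"
    if "f \<in> Arr B" for f
    using functor_typed[OF U_functor that] by (simp add: Hom_iff)
  have "on_arr U (f \<boxplus> g) = on_arr U f \<boxplus> on_arr U g"
    if "f \<in> Arr B" "g \<in> Arr B" "Dom B g = Dom B f" "Cod B g = Cod B f" for f g
  proof -
    have "on_arr T (on_arr U f \<boxplus> on_arr U g) = f \<boxplus> g"
      using that ty[of f] ty[of g] by simp
    then show ?thesis
      using U_T_arr[of "on_arr U f \<boxplus> on_arr U g"] that ty[of f] ty[of g] by simp
  qed
  then show "additive_functor B B U"
    using U_functor by (simp add: additive_functor_def Hom_iff)
qed

lemma \<eta>_typed [simp]: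
  assumes "A \<in> Obj B"
  shows "\<eta> A \<in> Arr B" "Dom B (\<eta> A) = on_obj T A" "Cod B (\<eta> A) = A"
  using \<eta>_natural assms by (auto simp: natural_transformation_def id_fctr_def Hom_iff)

lemma \<eta>_nat [simp]:
  assumes "f \<in> Arr B" "Cod B f = A"
  shows "\<eta> A \<cdot> on_arr T f = f \<cdot> \<eta> (Dom B f)"
  using \<eta>_natural[unfolded natural_transformation_def, THEN conjunct2, rule_format, of "Dom B f" A f] assms
  by (auto simp: id_fctr_def Hom_iff)

lemma \<eta>_nat_comp [simp]:
  assumes "f \<in> Arr B" "Cod B f = A" "x \<in> Arr B" "Cod B x = on_obj T (Dom B f)"
  shows "\<eta> A \<cdot> (on_arr T f \<cdot> x) = f \<cdot> (\<eta> (Dom B f) \<cdot> x)"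
  using comp_rewrite[OF \<eta>_nat[OF assms(1,2)], of x] assms by auto

lemma T_\<eta> [simp]: "X \<in> Obj B \<Longrightarrow> on_arr T (\<eta> X) = \<eta> (on_obj T X)"
  by (simp add: \<eta>_T)

lemma U_\<eta> [simp]: "X \<in> Obj B \<Longrightarrow> on_arr U (\<eta> X) = \<eta> (on_obj U X)"
  using U_T_arr[of "\<eta> (on_obj U X)"] by simp

end

section \<open>Degreewise split sequences with cocycle divisible by \<open>\<eta>\<close>\<close>

text \<open>
  A degreewise split sequence together with a factorisation \<open>k = \<eta> g\<close>, where \<open>g\<close> is a chain map from \<open>Z\<close> to
  \<open>Y(1)[1]\<close>: the sum in \<open>g_closed\<close> vanishes because of the sign in the differential of the shift.
\<close>
locale eta_split = eta_setting B T U \<eta> +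
  split_seq B Y E Z i p r s "\<lambda>n. \<eta> (trm Y (n + 1)) \<cdot> g n"
  for B :: "('o, 'm) cat" (structure) and T U :: "('o, 'm, 'o, 'm) fctr" and \<eta> :: "'o \<Rightarrow> 'm"
    and Y E Z :: "('o, 'm) cochain" and i p :: "('o, 'm) chain_map" and r s g :: "int \<Rightarrow> 'm" +
  assumes g_hom: "g n \<in> Hom B (trm Z n) (on_obj T (trm Y (n + 1)))"
    and g_closed: "on_arr T (dif Y (n + 1)) \<cdot> g n \<boxplus> g (n + 1) \<cdot> dif Z n =
      Zero B (trm Z n) (on_obj T (trm Y (n + 2)))"
begin

lemma g_typed [simp]: "g n \<in> Arr B" "Dom B (g n) = trm Z n" "Cod B (g n) = on_obj T (trm Y (n + 1))"
  using g_hom[of n] by (auto simp: Hom_iff)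

text \<open>
  The image of \<open>dif_s\<close> under \<open>T\<close>, with \<open>T \<eta>\<close> rewritten as \<open>\<eta>\<close> at \<open>Y(1)\<close>.  The proof disables \<open>\<eta>_nat\<close>, which would
  move \<open>\<eta>\<close> to the right past \<open>g(1)\<close>.
\<close>
lemma T_dif_s [simp]:
  "on_arr T (dif E n) \<cdot> on_arr T (s n) = on_arr T (s (n + 1)) \<cdot> on_arr T (dif Z n) \<boxplus>
    on_arr T (cmp i (n + 1)) \<cdot> (\<eta> (on_obj T (trm Y (n + 1))) \<cdot> on_arr T (g n))"
  "\<lbrakk>x \<in> Arr B; Cod B x = on_obj T (trm Z n)\<rbrakk> \<Longrightarrow> on_arr T (dif E n) \<cdot> (on_arr T (s n) \<cdot> x) =
    on_arr T (s (n + 1)) \<cdot> (on_arr T (dif Z n) \<cdot> x) \<boxplus>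
    on_arr T (cmp i (n + 1)) \<cdot> (\<eta> (on_obj T (trm Y (n + 1))) \<cdot> (on_arr T (g n) \<cdot> x))"
  using T.on_arr_rewrite(1)[OF dif_s, of n] T.on_arr_rewrite(2)[OF dif_s, of n x]
  by (simp_all del: \<eta>_nat \<eta>_nat_comp)

lemma T_r_dif:
  assumes "m = n + 1"
  shows "on_arr T (r m) \<cdot> on_arr T (dif E n) = on_arr T (dif Y n) \<cdot> on_arr T (r n) \<boxplus>
      \<eta> (on_obj T (trm Y (n + 1))) \<cdot> (on_arr T (g n) \<cdot> on_arr T (cmp p n))"
  using T.on_arr_rewrite(1)[OF r_dif[OF assms]] assms by (simp del: \<eta>_nat \<eta>_nat_comp)

lemma T_r_dif_comp [simp]:
  assumes "m = n + 1" "x \<in> Arr B" "Cod B x = on_obj T (trm E n)"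
  shows "on_arr T (r m) \<cdot> (on_arr T (dif E n) \<cdot> x) = on_arr T (dif Y n) \<cdot> (on_arr T (r n) \<cdot> x) \<boxplus>
      \<eta> (on_obj T (trm Y (n + 1))) \<cdot> (on_arr T (g n) \<cdot> (on_arr T (cmp p n) \<cdot> x))"
  using comp_rewrite[OF T_r_dif[OF assms(1)], of x] assms by (simp del: \<eta>_nat \<eta>_nat_comp)

lemma g_dif: "g (n + 1) \<cdot> dif Z n = Neg B (on_arr T (dif Y (n + 1)) \<cdot> g n)"
  using add_eq_zeroD[OF g_closed] by simp

lemma g_dif_comp [simp]:
  assumes "m = n + 1" "x \<in> Arr B" "Cod B x = trm Z n"
  shows "g m \<cdot> (dif Z n \<cdot> x) = Neg B (on_arr T (dif Y (n + 1)) \<cdot> (g n \<cdot> x))"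
  using comp_rewrite[OF g_dif, of x n] assms by simp

lemma g_chain [simp]:
  assumes "m = n + 1" "is_chain_map B c" "src c = X" "tgt c = Z"
  shows "g m \<cdot> (cmp c m \<cdot> dif X n) = Neg B (on_arr T (dif Y (n + 1)) \<cdot> (g n \<cdot> cmp c n))"
  using g_dif_comp[of m n "cmp c n"] assms by simp

end

context eta_setting
begin

lemma eta_splitI:
  assumes "split_seq B Y E Z i p r s (\<lambda>n. \<eta> (trm Y (n + 1)) \<cdot> g n)"
    and "\<And>n. g n \<in> Arr B" "\<And>n. Dom B (g n) = trm Z n" "\<And>n. Cod B (g n) = on_obj T (trm Y (n + 1))"
    and "\<And>n. g (n + 1) \<cdot> dif Z n = Neg B (on_arr T (dif Y (n + 1)) \<cdot> g n)"
  shows "eta_split B T U \<eta> Y E Z i p r s g"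
proof -
  interpret split_seq B Y E Z i p r s "\<lambda>n. \<eta> (trm Y (n + 1)) \<cdot> g n" by fact
  show ?thesis
    by unfold_locales (simp_all add: assms Hom_iff)
qed

text \<open>
  Every \<open>g\<close> occurs in a standard \<open>\<eta>\<close>-conflation, because \<open>k = \<eta> g\<close> inherits anticommutation from \<open>g\<close> by
  naturality.
\<close>
lemma eta_extension_exists:
  assumes Y: "is_complex B Y" and Z: "is_complex B Z"
    and g: "\<And>n. g n \<in> Arr B" "\<And>n. Dom B (g n) = trm Z n" "\<And>n. Cod B (g n) = on_obj T (trm Y (n + 1))"
    and g_dif: "\<And>n. g (n + 1) \<cdot> dif Z n = Neg B (on_arr T (dif Y (n + 1)) \<cdot> g n)"
  shows "\<exists>f r s. (cone_in B f, cone_out B f) \<in> standard_eta_conflations B T \<eta> \<and>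
    eta_split B T U \<eta> Y (cone B f) Z (cone_in B f) (cone_out B f) r s g"
proof -
  note [simp] = Y Z g
  define f where "f = \<lparr>src = unshift B Z, tgt = Y, cmp = (\<lambda>n. \<eta> (trm Y n) \<cdot> g (n - 1))\<rparr>"
  \<comment> \<open>The components in the form \<open>k (n - 1)\<close> that \<open>extension_exists\<close> produces for \<open>k = \<eta> g\<close>.\<close>
  have f_eq: "f = \<lparr>src = unshift B Z, tgt = Y, cmp = (\<lambda>n. \<eta> (trm Y (n - 1 + 1)) \<cdot> g (n - 1))\<rparr>"
    by (simp add: f_def)
  have closed: "dif Y (n + 1) \<cdot> (\<eta> (trm Y (n + 1)) \<cdot> g n) \<boxplus> \<eta> (trm Y (n + 1 + 1)) \<cdot> g (n + 1) \<cdot> dif Z n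
      = Zero B (trm Z n) (trm Y (n + 2))" for n
    using g_dif by simp
  have f: "is_chain_map B f"
    unfolding f_eq by (rule extension_exists(1)[OF Y Z _ _ _ closed]) simp_all
  have "\<exists>r s. split_seq B Y (cone B f) Z (cone_in B f) (cone_out B f) r s (\<lambda>n. \<eta> (trm Y (n + 1)) \<cdot> g n)"
    unfolding f_eq by (rule extension_exists(2)[OF Y Z _ _ _ closed]) simp_all
  then obtain r s where rs: "split_seq B Y (cone B f) Z (cone_in B f) (cone_out B f) r s
      (\<lambda>n. \<eta> (trm Y (n + 1)) \<cdot> g n)" by blast
  define h where "h = \<lparr>src = unshift B Z, tgt = on_obj (cpx_fctr T) Y, cmp = (\<lambda>n. g (n - 1))\<rparr>"
  have "on_arr T (dif Y n) \<cdot> g (n - 1) = Neg B (g n \<cdot> dif Z (n - 1))" for n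
    using g_dif[of "n - 1"] by simp
  then have h: "is_chain_map B h"
    by (intro chain_mapI) (auto simp: h_def)
  have "f = cpx_eta T \<eta> (tgt f) \<cdot>\<^bsub>Cpx B\<^esub> h"
    by (auto simp: f_def h_def cpx_eta_def)
  with h have "factors_through_eta B T \<eta> f"
    unfolding factors_through_eta_def by (intro bexI[where x = h]) (auto simp: f_def h_def)
  with f have "(cone_in B f, cone_out B f) \<in> standard_eta_conflations B T \<eta>"
    by (auto simp: standard_eta_conflations_def)
  moreover have "eta_split B T U \<eta> Y (cone B f) Z (cone_in B f) (cone_out B f) r s g"
    by (rule eta_splitI[OF rs]) (simp_all add: g_dif)
  ultimately show ?thesis by blast
qed

text \<open>
  The standard \<open>\<eta>\<close>-conflation with the same \<open>g\<close> is isomorphic to the given sequence.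
\<close>
lemma eta_conflationI:
  assumes "eta_split B T U \<eta> Y E Z i p r s g"
  shows "(i, p) \<in> eta_conflations B T \<eta>"
proof -
  interpret S: eta_split B T U \<eta> Y E Z i p r s g by fact
  obtain f r' s' where st: "(cone_in B f, cone_out B f) \<in> standard_eta_conflations B T \<eta>"
    and S': "eta_split B T U \<eta> Y (cone B f) Z (cone_in B f) (cone_out B f) r' s' g"
    using eta_extension_exists[of Y Z g] S.g_dif by auto
  have "pair_iso (Cpx B) (i, p) (cone_in B f, cone_out B f)"
    by (rule split_seq_iso[OF S.split_seq_axioms eta_split.axioms(2)[OF S']])
  with st S.exact show ?thesis by (auto simp: eta_conflations_def)
qed

text \<open>
  The cocycle of the transported sequence is \<open>a(1)\<^sup>-\<^sup>1 g c\<close>, by naturality of \<open>\<eta>\<close>.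
\<close>
lemma eta_split_transport:
  assumes S: "eta_split B T U \<eta> Y E Z i p r s g"
    and ex: "i' \<in> Arr (Cpx B)" "p' \<in> Arr (Cpx B)" "src p' = tgt i'"
    and iso: "pair_iso (Cpx B) (i', p') (i, p)"
  shows "\<exists>r' s' g'. eta_split B T U \<eta> (src i') (tgt i') (tgt p') i' p' r' s' g'"
proof -
  interpret S: eta_split B T U \<eta> Y E Z i p r s g by fact
  from iso obtain a b c where abc: "a \<in> Hom (Cpx B) (src i') Y" "b \<in> Hom (Cpx B) (tgt i') E"
      "c \<in> Hom (Cpx B) (tgt p') Z"
    and isos: "iso_arr (Cpx B) a" "iso_arr (Cpx B) b" "iso_arr (Cpx B) c"
    and comm: "b \<cdot>\<^bsub>Cpx B\<^esub> i' = i \<cdot>\<^bsub>Cpx B\<^esub> a" "c \<cdot>\<^bsub>Cpx B\<^esub> p' = p \<cdot>\<^bsub>Cpx B\<^esub> b"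
    by (auto simp: pair_iso_def simp del: Cpx_sel(6))
  have inv: "\<exists>f'. f' \<in> Hom (Cpx B) Q P \<and> f' \<cdot>\<^bsub>Cpx B\<^esub> f = ident (Cpx B) P \<and> f \<cdot>\<^bsub>Cpx B\<^esub> f' = ident (Cpx B) Q"
    if "iso_arr (Cpx B) f" "f \<in> Hom (Cpx B) P Q" for f P Q
    using that unfolding iso_arr_def by (auto simp del: Cpx_sel(5,6))
  obtain a' where a': "a' \<in> Hom (Cpx B) Y (src i')" "a' \<cdot>\<^bsub>Cpx B\<^esub> a = ident (Cpx B) (src i')"
      "a \<cdot>\<^bsub>Cpx B\<^esub> a' = ident (Cpx B) Y"
    using inv[OF isos(1) abc(1)] by blast
  obtain b' where b': "b' \<in> Hom (Cpx B) E (tgt i')" "b' \<cdot>\<^bsub>Cpx B\<^esub> b = ident (Cpx B) (tgt i')"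
      "b \<cdot>\<^bsub>Cpx B\<^esub> b' = ident (Cpx B) E"
    using inv[OF isos(2) abc(2)] by blast
  obtain c' where c': "c' \<in> Hom (Cpx B) Z (tgt p')" "c' \<cdot>\<^bsub>Cpx B\<^esub> c = ident (Cpx B) (tgt p')"
      "c \<cdot>\<^bsub>Cpx B\<^esub> c' = ident (Cpx B) Z"
    using inv[OF isos(3) abc(3)] by blast
  have "i' \<in> Hom (Cpx B) (src i') (tgt i')" "p' \<in> Hom (Cpx B) (tgt i') (tgt p')"
    using ex by auto
  note * = split_seq_transport[OF S.split_seq_axioms abc(1) a' abc(2) b' abc(3) c' this(1) comm(1) this(2) comm(2)]
  have [simp]: "is_chain_map B a" "src a = src i'" "tgt a = Y" "is_chain_map B a'" "src a' = Y" "tgt a' = src i'"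
    "is_chain_map B c" "src c = tgt p'" "tgt c = Z" "is_chain_map B i'" "is_chain_map B p'"
    using abc a'(1) ex by auto
  define g' where "g' n = on_arr T (cmp a' (n + 1)) \<cdot> (g n \<cdot> cmp c n)" for n
  have k_eq: "cmp a' (n + 1) \<cdot> (\<eta> (trm Y (n + 1)) \<cdot> g n \<cdot> cmp c n) = \<eta> (trm (src i') (n + 1)) \<cdot> g' n" for n
    by (simp add: g'_def)
  have "eta_split B T U \<eta> (src i') (tgt i') (tgt p') i' p'
     (\<lambda>n. cmp a' n \<cdot> (r n \<cdot> cmp b n)) (\<lambda>n. cmp b' n \<cdot> (s n \<cdot> cmp c n)) g'"
    using *[unfolded k_eq]
    by (intro eta_split.intro eta_setting_axioms eta_split_axioms.intro) (simp_all add: g'_def Hom_iff)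
  then show ?thesis by blast
qed

text \<open>
  If \<open>f = \<eta> h\<close>, then the cone of \<open>f\<close> has \<open>k = \<eta> h\<close> up to the shift of degrees, so \<open>g\<close> is \<open>h\<close>.
\<close>
lemma eta_conflationD:
  assumes "(i, p) \<in> eta_conflations B T \<eta>"
  shows "\<exists>r s g. eta_split B T U \<eta> (src i) (tgt i) (tgt p) i p r s g"
proof -
  obtain f where ex: "exact_pair (Cpx B) i p" and f [simp]: "is_chain_map B f"
    and fac: "factors_through_eta B T \<eta> f"
    and iso: "pair_iso (Cpx B) (i, p) (cone_in B f, cone_out B f)"
    using assms by (auto simp: eta_conflations_def standard_eta_conflations_def)
  obtain h where h [simp]: "is_chain_map B h" "src h = src f" "tgt h = on_obj (cpx_fctr T) (tgt f)"
    and fh: "f = cpx_eta T \<eta> (tgt f) \<cdot>\<^bsub>Cpx B\<^esub> h"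
    using fac by (auto simp: factors_through_eta_def simp del: Cpx_sel(6))
  have fh: "cmp f n = \<eta> (trm (tgt f) n) \<cdot> cmp h n" for n
    using arg_cong[OF fh, of "\<lambda>f. cmp f n"] by (simp add: cpx_eta_def)
  have hd: "on_arr T (dif (tgt f) (n + 1)) \<cdot> cmp h (n + 1) = cmp h (n + 2) \<cdot> dif (src f) (n + 1)" for n
    using chain_comm[OF h(1,3), of "n + 1"] by simp
  have "eta_split B T U \<eta> (tgt f) (cone B f) (cpx_shift B (src f)) (cone_in B f) (cone_out B f)
    (\<lambda>n. bp_pr2 (cone_term B f n)) (\<lambda>n. bp_in1 (cone_term B f n)) (\<lambda>n. cmp h (n + 1))"
    using cone_split_seq[OF f, unfolded fh]
    by (intro eta_split.intro eta_setting_axioms eta_split_axioms.intro)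
      (simp_all add: Hom_iff hd)
  then show ?thesis
    by (rule eta_split_transport[OF _ _ _ _ iso])
      (use ex in \<open>auto simp: exact_pair_def is_kernel_def\<close>)
qed

end

section \<open>The exact structure\<close>

context eta_setting
begin

text \<open>
  The kernel of the composite is the pullback \<open>K\<close> of \<open>p\<close> along \<open>j\<close>, and the composite is split by \<open>s s'\<close>.  From
  \<open>d s s' = s s' d + s j \<eta> g' + i \<eta> g s'\<close> one reads off the cocycle \<open>h\<close>, by collecting the last two terms in \<open>K\<close>
  and pulling \<open>\<eta>\<close> to the left.
\<close>
lemma eta_deflation_comp:
  assumes "eta_split B T U \<eta> Y E Z i p r s g" "eta_split B T U \<eta> V Z W j q r' s' g'"
  shows "\<exists>K m r'' s'' h. eta_split B T U \<eta> K E W m (q \<cdot>\<^bsub>Cpx B\<^esub> p) r'' s'' h"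
proof -
  interpret S: eta_split B T U \<eta> Y E Z i p r s g by fact
  interpret S': eta_split B T U \<eta> V Z W j q r' s' g' by fact
  obtain K iK pK rK sK where "eta_split B T U \<eta> Y K V iK pK rK sK (\<lambda>n. g n \<cdot> cmp j n)"
    using eta_extension_exists[of Y V "\<lambda>n. g n \<cdot> cmp j n"] by auto
  then interpret K: eta_split B T U \<eta> Y K V iK pK rK sK "\<lambda>n. g n \<cdot> cmp j n" .
  \<comment> \<open>The projection of the pullback \<open>K\<close> to \<open>E\<close>.\<close>
  define m where "m = split_map B pK rK s i (ident (Cpx B) Y) j"
  define h where "h n = on_arr T (cmp iK (n + 1)) \<cdot> (g n \<cdot> s' n) \<boxplus> on_arr T (sK (n + 1)) \<cdot> g' n" for n
  have m: "is_chain_map B m"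
    unfolding m_def by (rule split_map_chain[OF K.split_seq_axioms S.split_seq_axioms]) auto
  have j_split: "s n \<cdot> (cmp j n \<cdot> (r' n \<cdot> cmp p n)) \<boxplus> s n \<cdot> (s' n \<cdot> (cmp q n \<cdot> cmp p n)) = s n \<cdot> cmp p n" for n
    using arg_cong[OF S'.split_left[of "cmp p n" n], of "\<lambda>x. s n \<cdot> x"] by simp
  have split: "cmp i n \<cdot> r n \<boxplus> (s n \<cdot> (cmp j n \<cdot> (r' n \<cdot> cmp p n)) \<boxplus> s n \<cdot> (s' n \<cdot> (cmp q n \<cdot> cmp p n))) =
      ident B (trm E n)" for n
    unfolding j_split by (rule S.split)
  have seq: "split_seq B K E W m (q \<cdot>\<^bsub>Cpx B\<^esub> p) (\<lambda>n. cmp iK n \<cdot> r n \<boxplus> sK n \<cdot> (r' n \<cdot> cmp p n))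
      (\<lambda>n. s n \<cdot> s' n) (\<lambda>n. \<eta> (trm K (n + 1)) \<cdot> h n)"
    by unfold_locales
      (use m K.split split in \<open>simp_all add: m_def h_def Hom_iff add_ac\<close>)
  \<comment> \<open>Expanding \<open>g d s'\<close> in two ways yields the term \<open>g j \<eta> g'\<close> that cancels the defect of \<open>s\<^sub>K(1)\<close>.\<close>
  have gs: "g (n + 1) \<cdot> (s' (n + 1) \<cdot> dif W n) =
      Neg B (on_arr T (dif Y (n + 1)) \<cdot> (g n \<cdot> s' n)) \<boxplus>
      Neg B (g (n + 1) \<cdot> (cmp j (n + 1) \<cdot> (\<eta> (trm V (n + 1)) \<cdot> g' n)))" for n
  proof -
    have "g (n + 1) \<cdot> (s' (n + 1) \<cdot> dif W n) \<boxplus> g (n + 1) \<cdot> (cmp j (n + 1) \<cdot> (\<eta> (trm V (n + 1)) \<cdot> g' n))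
      = Neg B (on_arr T (dif Y (n + 1)) \<cdot> (g n \<cdot> s' n))"
      using comp_rewrite[OF S.g_dif, of "s' n" n] by (simp del: S.g_dif_comp)
    then show ?thesis by (rule add_eq_left) auto
  qed
  have "eta_split B T U \<eta> K E W m (q \<cdot>\<^bsub>Cpx B\<^esub> p) (\<lambda>n. cmp iK n \<cdot> r n \<boxplus> sK n \<cdot> (r' n \<cdot> cmp p n))
      (\<lambda>n. s n \<cdot> s' n) h"
    by (rule eta_splitI[OF seq]) (simp_all add: h_def gs S'.g_dif neg_add add_ac)
  then show ?thesis by blast
qed

text \<open>
  Dual to \<open>eta_deflation_comp\<close>: the cokernel of the composite is the pushout \<open>D\<close> of \<open>j\<close> along \<open>p\<close>, and the
  composite is split by \<open>r r'\<close>.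
\<close>
lemma eta_inflation_comp:
  assumes "eta_split B T U \<eta> Y E Z i p r s g" "eta_split B T U \<eta> E F V j q r' s' g'"
  shows "\<exists>D m r'' s'' h. eta_split B T U \<eta> Y F D (j \<cdot>\<^bsub>Cpx B\<^esub> i) m r'' s'' h"
proof -
  interpret S: eta_split B T U \<eta> Y E Z i p r s g by fact
  interpret S': eta_split B T U \<eta> E F V j q r' s' g' by fact
  obtain D iD pD rD sD where "eta_split B T U \<eta> Z D V iD pD rD sD (\<lambda>n. on_arr T (cmp p (n + 1)) \<cdot> g' n)"
    using eta_extension_exists[of Z V "\<lambda>n. on_arr T (cmp p (n + 1)) \<cdot> g' n"] by (auto simp: S'.g_dif)
  then interpret D: eta_split B T U \<eta> Z D V iD pD rD sD "\<lambda>n. on_arr T (cmp p (n + 1)) \<cdot> g' n" .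
  \<comment> \<open>The map from \<open>F\<close> to the pushout \<open>D\<close>.\<close>
  define m where "m = split_map B q r' sD iD p (ident (Cpx B) V)"
  define h where "h n = g n \<cdot> rD n \<boxplus> on_arr T (r (n + 1)) \<cdot> (g' n \<cdot> cmp pD n)" for n
  have m: "is_chain_map B m"
    unfolding m_def by (rule split_map_chain[OF S'.split_seq_axioms D.split_seq_axioms]) auto
  have i_split: "cmp j n \<cdot> (cmp i n \<cdot> (r n \<cdot> r' n)) \<boxplus> cmp j n \<cdot> (s n \<cdot> (cmp p n \<cdot> r' n)) = cmp j n \<cdot> r' n" for n
    using arg_cong[OF S.split_left[of "r' n" n], of "\<lambda>x. cmp j n \<cdot> x"] by simp
  have split: "(cmp j n \<cdot> (cmp i n \<cdot> (r n \<cdot> r' n)) \<boxplus> cmp j n \<cdot> (s n \<cdot> (cmp p n \<cdot> r' n))) \<boxplus> s' n \<cdot> cmp q n =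
      ident B (trm F n)" for n
    unfolding i_split by (rule S'.split)
  have seq: "split_seq B Y F D (j \<cdot>\<^bsub>Cpx B\<^esub> i) m (\<lambda>n. r n \<cdot> r' n)
      (\<lambda>n. cmp j n \<cdot> (s n \<cdot> rD n) \<boxplus> s' n \<cdot> cmp pD n) (\<lambda>n. \<eta> (trm Y (n + 1)) \<cdot> h n)"
    by unfold_locales
      (use m D.split split in \<open>simp_all add: m_def h_def Hom_iff add_ac\<close>)
  have "eta_split B T U \<eta> Y F D (j \<cdot>\<^bsub>Cpx B\<^esub> i) m (\<lambda>n. r n \<cdot> r' n)
      (\<lambda>n. cmp j n \<cdot> (s n \<cdot> rD n) \<boxplus> s' n \<cdot> cmp pD n) h"
    by (rule eta_splitI[OF seq]) (simp_all add: h_def S'.g_dif neg_add add_cancel_pair)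
  then show ?thesis by blast
qed

abbreviation "\<E> \<equiv> eta_conflations B T \<eta>"

lemma deflation_iff: "deflation \<E> p \<longleftrightarrow> (\<exists>Y E Z i r s g. eta_split B T U \<eta> Y E Z i p r s g)"
  unfolding deflation_def by (metis eta_conflationD eta_conflationI)

lemma inflation_iff: "inflation \<E> i \<longleftrightarrow> (\<exists>Y E Z p r s g. eta_split B T U \<eta> Y E Z i p r s g)"
  unfolding inflation_def by (metis eta_conflationD eta_conflationI)

lemma eta_split_ends:
  assumes "eta_split B T U \<eta> Y E Z i p r s g"
  shows "src i = Y" "tgt i = E" "src p = E" "tgt p = Z" "is_chain_map B i" "is_chain_map B p"
proof -
  interpret eta_split B T U \<eta> Y E Z i p r s g by fact
  show "src i = Y" "tgt i = E" "src p = E" "tgt p = Z" "is_chain_map B i" "is_chain_map B p" by simp_all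
qed

lemma deflation_iso_source:
  assumes "deflation \<E> p" and t0: "t \<in> Hom (Cpx B) X (src p)" "t' \<in> Hom (Cpx B) (src p) X"
    "t' \<cdot>\<^bsub>Cpx B\<^esub> t = ident (Cpx B) X" "t \<cdot>\<^bsub>Cpx B\<^esub> t' = ident (Cpx B) (src p)"
  shows "deflation \<E> (p \<cdot>\<^bsub>Cpx B\<^esub> t)"
proof -
  interpret K: preadditive_category "Cpx B" by (rule Cpx_preadditive)
  obtain Y E Z i r s g where S: "eta_split B T U \<eta> Y E Z i p r s g"
    using assms(1) by (auto simp: deflation_iff)
  interpret S: eta_split B T U \<eta> Y E Z i p r s g by (rule S)
  note t = t0[unfolded S.typed(5)]
  have [simp]: "is_chain_map B t" "src t = X" "tgt t = E" "is_chain_map B t'" "src t' = E" "tgt t' = X"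
    using t by auto
  have tti: "t \<cdot>\<^bsub>Cpx B\<^esub> (t' \<cdot>\<^bsub>Cpx B\<^esub> i) = i \<cdot>\<^bsub>Cpx B\<^esub> ident (Cpx B) Y"
  proof -
    have "t \<cdot>\<^bsub>Cpx B\<^esub> (t' \<cdot>\<^bsub>Cpx B\<^esub> i) = ident (Cpx B) E \<cdot>\<^bsub>Cpx B\<^esub> i"
      by (rule K.comp_rewrite[OF t(4)]) auto
    also have "\<dots> = i" by (rule K.comp_ident) auto
    also have "\<dots> = i \<cdot>\<^bsub>Cpx B\<^esub> ident (Cpx B) Y" by (rule K.comp_ident(1)[symmetric]) auto
    finally show ?thesis .
  qed
  have ptt: "ident (Cpx B) Z \<cdot>\<^bsub>Cpx B\<^esub> (p \<cdot>\<^bsub>Cpx B\<^esub> t) = p \<cdot>\<^bsub>Cpx B\<^esub> t"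
    by (rule K.comp_ident) auto
  have "pair_iso (Cpx B) (t' \<cdot>\<^bsub>Cpx B\<^esub> i, p \<cdot>\<^bsub>Cpx B\<^esub> t) (i, p)"
    unfolding pair_iso_def prod.case
    using K.iso_arr_ident[of Y] K.iso_arr_ident[of "Z"] K.iso_arrI[OF t]
    by (intro bexI[where x = "ident (Cpx B) Y"] bexI[where x = t] bexI[where x = "ident (Cpx B) Z"]
        conjI tti ptt) auto
  from eta_split_transport[OF S _ _ _ this]
  obtain r' s' g' where "eta_split B T U \<eta> Y X Z (t' \<cdot>\<^bsub>Cpx B\<^esub> i) (p \<cdot>\<^bsub>Cpx B\<^esub> t) r' s' g'"
    by auto
  then show ?thesis unfolding deflation_iff by blast
qed

lemma inflation_iso_target:
  assumes "inflation \<E> i" and t0: "t \<in> Hom (Cpx B) (tgt i) X" "t' \<in> Hom (Cpx B) X (tgt i)"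
    "t' \<cdot>\<^bsub>Cpx B\<^esub> t = ident (Cpx B) (tgt i)" "t \<cdot>\<^bsub>Cpx B\<^esub> t' = ident (Cpx B) X"
  shows "inflation \<E> (t \<cdot>\<^bsub>Cpx B\<^esub> i)"
proof -
  interpret K: preadditive_category "Cpx B" by (rule Cpx_preadditive)
  obtain Y E Z p r s g where S: "eta_split B T U \<eta> Y E Z i p r s g"
    using assms(1) by (auto simp: inflation_iff)
  interpret S: eta_split B T U \<eta> Y E Z i p r s g by (rule S)
  note t = t0[unfolded S.typed(3)]
  have [simp]: "is_chain_map B t" "src t = E" "tgt t = X" "is_chain_map B t'" "src t' = X" "tgt t' = E"
    using t by auto
  have tti: "t' \<cdot>\<^bsub>Cpx B\<^esub> (t \<cdot>\<^bsub>Cpx B\<^esub> i) = i \<cdot>\<^bsub>Cpx B\<^esub> ident (Cpx B) Y"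
  proof -
    have "t' \<cdot>\<^bsub>Cpx B\<^esub> (t \<cdot>\<^bsub>Cpx B\<^esub> i) = ident (Cpx B) E \<cdot>\<^bsub>Cpx B\<^esub> i"
      by (rule K.comp_rewrite[OF t(3)]) auto
    also have "\<dots> = i" by (rule K.comp_ident) auto
    also have "\<dots> = i \<cdot>\<^bsub>Cpx B\<^esub> ident (Cpx B) Y" by (rule K.comp_ident(1)[symmetric]) auto
    finally show ?thesis .
  qed
  have ptt: "ident (Cpx B) Z \<cdot>\<^bsub>Cpx B\<^esub> (p \<cdot>\<^bsub>Cpx B\<^esub> t') = p \<cdot>\<^bsub>Cpx B\<^esub> t'"
    by (rule K.comp_ident) auto
  have "pair_iso (Cpx B) (t \<cdot>\<^bsub>Cpx B\<^esub> i, p \<cdot>\<^bsub>Cpx B\<^esub> t') (i, p)"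
    unfolding pair_iso_def prod.case
    using K.iso_arr_ident[of "Y"] K.iso_arr_ident[of Z] K.iso_arrI[OF t(2,1,4,3)]
    by (intro bexI[where x = "ident (Cpx B) Y"] bexI[where x = t'] bexI[where x = "ident (Cpx B) Z"]
        conjI tti ptt) auto
  from eta_split_transport[OF S _ _ _ this]
  obtain r' s' g' where "eta_split B T U \<eta> Y X Z (t \<cdot>\<^bsub>Cpx B\<^esub> i) (p \<cdot>\<^bsub>Cpx B\<^esub> t') r' s' g'"
    by auto
  then show ?thesis unfolding inflation_iff by blast
qed

lemma eta_pullback:
  assumes "deflation \<E> p" and f [simp]: "is_chain_map B f" "tgt f = tgt p"
  shows "\<exists>q m. deflation \<E> q \<and> is_pullback (Cpx B) p f q m"
proof -
  obtain Y E Z i r s g where S: "eta_split B T U \<eta> Y E Z i p r s g"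
    using assms(1) by (auto simp: deflation_iff)
  interpret S: eta_split B T U \<eta> Y E Z i p r s g by (rule S)
  obtain E' i' q r' s' where S': "eta_split B T U \<eta> Y E' (src f) i' q r' s' (\<lambda>n. g n \<cdot> cmp f n)"
    using eta_extension_exists[of Y "src f" "\<lambda>n. g n \<cdot> cmp f n"] by auto
  interpret S': eta_split B T U \<eta> Y E' "src f" i' q r' s' "\<lambda>n. g n \<cdot> cmp f n" by (rule S')
  have "deflation \<E> q" using eta_conflationI[OF S'] by (auto simp: deflation_def)
  moreover note split_pullback[OF S.split_seq_axioms S'.split_seq_axioms, of f]
  ultimately show ?thesis by auto
qed

lemma eta_pushout:
  assumes "inflation \<E> i" and f [simp]: "is_chain_map B f" "src f = src i"
  shows "\<exists>j m. inflation \<E> j \<and> is_pushout (Cpx B) i f j m"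
proof -
  obtain Y E Z p r s g where S: "eta_split B T U \<eta> Y E Z i p r s g"
    using assms(1) by (auto simp: inflation_iff)
  interpret S: eta_split B T U \<eta> Y E Z i p r s g by (rule S)
  obtain E' j q r' s' where S': "eta_split B T U \<eta> (tgt f) E' Z j q r' s' (\<lambda>n. on_arr T (cmp f (n + 1)) \<cdot> g n)"
    using eta_extension_exists[of "tgt f" Z "\<lambda>n. on_arr T (cmp f (n + 1)) \<cdot> g n"] by (auto simp: S.g_dif)
  interpret S': eta_split B T U \<eta> "tgt f" E' Z j q r' s' "\<lambda>n. on_arr T (cmp f (n + 1)) \<cdot> g n" by (rule S')
  have "inflation \<E> j" using eta_conflationI[OF S'] by (auto simp: inflation_def)
  moreover note split_pushout[OF S.split_seq_axioms S'.split_seq_axioms, of f]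
  ultimately show ?thesis by auto
qed

text \<open>
  On a zero complex all identities and differentials vanish, so the identity is both maps and both halves of
  the splitting.
\<close>
lemma ident_zero_deflation:
  assumes "zero_object (Cpx B) Z"
  shows "deflation \<E> (ident (Cpx B) Z)"
proof -
  interpret K: preadditive_category "Cpx B" by (rule Cpx_preadditive)
  have Z [simp]: "is_complex B Z" using assms by (simp add: zero_object_def)
  have "ident (Cpx B) Z = Zero (Cpx B) Z Z"
  proof -
    have "ident (Cpx B) Z \<in> Hom (Cpx B) Z Z" "Zero (Cpx B) Z Z \<in> Hom (Cpx B) Z Z" by auto
    moreover have "\<exists>!f. f \<in> Hom (Cpx B) Z Z" using assms by (simp add: zero_object_def)
    ultimately show ?thesis by blast
  qed
  then have id: "ident B (trm Z n) = Zero B (trm Z n) (trm Z n)" for n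
    by (simp add: fun_eq_iff)
  have dif: "dif Z n = Zero B (trm Z n) (trm Z (n + 1))" for n
    using comp_ident(1)[of "dif Z n" "trm Z n"] by (simp add: id)
  have "split_seq B Z Z Z (ident (Cpx B) Z) (ident (Cpx B) Z) (\<lambda>n. ident B (trm Z n)) (\<lambda>n. ident B (trm Z n))
      (\<lambda>n. \<eta> (trm Z (n + 1)) \<cdot> Zero B (trm Z n) (on_obj T (trm Z (n + 1))))"
    by unfold_locales (auto simp: Hom_iff id dif)
  then have "eta_split B T U \<eta> Z Z Z (ident (Cpx B) Z) (ident (Cpx B) Z) (\<lambda>n. ident B (trm Z n))
      (\<lambda>n. ident B (trm Z n)) (\<lambda>n. Zero B (trm Z n) (on_obj T (trm Z (n + 1))))"
    by (rule eta_splitI) auto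
  then show ?thesis unfolding deflation_iff by blast
qed

text \<open>
  Arbitrary pullbacks and pushouts are compared with the constructed ones by their uniqueness up to
  isomorphism.
\<close>
lemma eta_exact_category: "exact_category (Cpx B) \<E>"
proof -
  interpret K: additive_category "Cpx B" by (rule Cpx_additive)
  show ?thesis
  proof
    show "exact_pair (Cpx B) i p" if "(i, p) \<in> \<E>" for i p
      using that by (simp add: eta_conflations_def)
  next
    fix i p i' p'
    assume c: "(i, p) \<in> \<E>" and ex': "exact_pair (Cpx B) i' p'" and iso: "pair_iso (Cpx B) (i, p) (i', p')"
    have ex: "exact_pair (Cpx B) i p" using c by (simp add: eta_conflations_def)
    have "pair_iso (Cpx B) (i', p') (i, p)"
      by (rule K.pair_iso_sym[OF iso]) (use ex ex' in \<open>auto simp: exact_pair_def is_kernel_def\<close>)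
    moreover obtain r s g where "eta_split B T U \<eta> (src i) (tgt i) (tgt p) i p r s g"
      using eta_conflationD[OF c] by blast
    ultimately have "\<exists>r s g. eta_split B T U \<eta> (src i') (tgt i') (tgt p') i' p' r s g"
      using ex' by (intro eta_split_transport) (auto simp: exact_pair_def is_kernel_def)
    then show "(i', p') \<in> \<E>" using eta_conflationI by blast
  next
    show "deflation \<E> (ident (Cpx B) Z)" if "zero_object (Cpx B) Z" for Z
      using that by (rule ident_zero_deflation)
  next
    fix p q assume "deflation \<E> p" "deflation \<E> q" and eq: "Dom (Cpx B) q = Cod (Cpx B) p"
    then obtain Y E Z i r s g V Z' W j r' s' g' where S: "eta_split B T U \<eta> Y E Z i p r s g"
      and S': "eta_split B T U \<eta> V Z' W j q r' s' g'"
      unfolding deflation_iff by blast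
    have "Z' = Z" using eq eta_split_ends[OF S] eta_split_ends[OF S'] by simp
    from eta_deflation_comp[OF S S'[unfolded this]] show "deflation \<E> (q \<cdot>\<^bsub>Cpx B\<^esub> p)"
      unfolding deflation_def using eta_conflationI by blast
  next
    fix i j assume "inflation \<E> i" "inflation \<E> j" and eq: "Dom (Cpx B) j = Cod (Cpx B) i"
    then obtain Y E Z p r s g E' F V q r' s' g' where S: "eta_split B T U \<eta> Y E Z i p r s g"
      and S': "eta_split B T U \<eta> E' F V j q r' s' g'"
      unfolding inflation_iff by blast
    have "E' = E" using eq eta_split_ends[OF S] eta_split_ends[OF S'] by simp
    from eta_inflation_comp[OF S S'[unfolded this]] show "inflation \<E> (j \<cdot>\<^bsub>Cpx B\<^esub> i)"
      unfolding inflation_def using eta_conflationI by blast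
  next
    fix p f assume "deflation \<E> p" "f \<in> Arr (Cpx B)" "Cod (Cpx B) f = Cod (Cpx B) p"
    then show "\<exists>q g. is_pullback (Cpx B) p f q g" using eta_pullback[of p f] by auto
  next
    fix p f q g assume p: "deflation \<E> p" and pb: "is_pullback (Cpx B) p f q g"
    then obtain q' m where q': "deflation \<E> q'" "is_pullback (Cpx B) p f q' m"
      using eta_pullback[of p f] by (auto simp: is_pullback_def)
    from K.pullback_unique[OF pb q'(2)] obtain t t' where "t \<in> Hom (Cpx B) (src q) (src q')"
      "t' \<in> Hom (Cpx B) (src q') (src q)" "t' \<cdot>\<^bsub>Cpx B\<^esub> t = ident (Cpx B) (src q)"
      "t \<cdot>\<^bsub>Cpx B\<^esub> t' = ident (Cpx B) (src q')" "q' \<cdot>\<^bsub>Cpx B\<^esub> t = q"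
      unfolding Cpx_sel(3) by blast
    then show "deflation \<E> q" using deflation_iso_source[OF q'(1)] by metis
  next
    fix i f assume "inflation \<E> i" "f \<in> Arr (Cpx B)" "Dom (Cpx B) f = Dom (Cpx B) i"
    then show "\<exists>j g. is_pushout (Cpx B) i f j g" using eta_pushout[of i f] by auto
  next
    fix i f j g assume i: "inflation \<E> i" and po: "is_pushout (Cpx B) i f j g"
    then obtain j' m where j': "inflation \<E> j'" "is_pushout (Cpx B) i f j' m"
      using eta_pushout[of i f] by (auto simp: is_pushout_def)
    from K.pushout_unique[OF j'(2) po] obtain t t' where "t \<in> Hom (Cpx B) (tgt j') (tgt j)"
      "t' \<in> Hom (Cpx B) (tgt j) (tgt j')" "t' \<cdot>\<^bsub>Cpx B\<^esub> t = ident (Cpx B) (tgt j')"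
      "t \<cdot>\<^bsub>Cpx B\<^esub> t' = ident (Cpx B) (tgt j)" "t \<cdot>\<^bsub>Cpx B\<^esub> j' = j"
      unfolding Cpx_sel(4) by blast
    then show "inflation \<E> j" using inflation_iso_target[OF j'(1)] by metis
  qed
qed

section \<open>Complexes on which \<open>\<eta>\<close> is null-homotopic\<close>

text \<open>
  The homotopy has components \<open>\<sigma> n\<close> from \<open>X(1)\<^sup>n\<^sup>+\<^sup>1\<close> to \<open>X\<^sup>n\<close>; indexing it by the degree of its target makes
  the equation at degree \<open>n + 1\<close> free of subtractions.
\<close>
definition eta_contractible :: "('o, 'm) cochain \<Rightarrow> bool" where
  "eta_contractible X \<longleftrightarrow> is_complex B X \<and>
    (\<exists>\<sigma>. \<forall>n. \<sigma> n \<in> Hom B (on_obj T (trm X (n + 1))) (trm X n) \<and>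
      dif X n \<cdot> \<sigma> n \<boxplus> \<sigma> (n + 1) \<cdot> on_arr T (dif X (n + 1)) = \<eta> (trm X (n + 1)))"

lemma eta_contractibleE:
  assumes "eta_contractible X"
  obtains \<sigma> where "is_complex B X"
    "\<And>n. \<sigma> n \<in> Arr B" "\<And>n. Dom B (\<sigma> n) = on_obj T (trm X (n + 1))" "\<And>n. Cod B (\<sigma> n) = trm X n"
    "\<And>n. dif X n \<cdot> \<sigma> n \<boxplus> \<sigma> (n + 1) \<cdot> on_arr T (dif X (n + 1)) = \<eta> (trm X (n + 1))"
  using assms unfolding eta_contractible_def Hom_iff by blast

lemma eta_contractibleI:
  assumes "is_complex B X"
    "\<And>n. \<sigma> n \<in> Arr B" "\<And>n. Dom B (\<sigma> n) = on_obj T (trm X (n + 1))" "\<And>n. Cod B (\<sigma> n) = trm X n"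
    "\<And>n. dif X n \<cdot> \<sigma> n \<boxplus> \<sigma> (n + 1) \<cdot> on_arr T (dif X (n + 1)) = \<eta> (trm X (n + 1))"
  shows "eta_contractible X"
  using assms unfolding eta_contractible_def Hom_iff by blast

text \<open>
  The map \<open>w r\<close> extends \<open>w\<close> in each degree and differs from a chain map by \<open>w \<eta> g p = \<eta>\<^sub>X w(1) g p\<close>.  The
  correction \<open>\<sigma> w(1) g p\<close> vanishes on \<open>Y\<close> and removes this defect.
\<close>
lemma eta_contractible_extends:
  assumes "eta_split B T U \<eta> Y E Z i p r s g" and "eta_contractible X"
    and w [simp]: "is_chain_map B w" "src w = Y" "tgt w = X"
  shows "\<exists>v. is_chain_map B v \<and> src v = E \<and> tgt v = X \<and> v \<cdot>\<^bsub>Cpx B\<^esub> i = w"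
proof -
  interpret S: eta_split B T U \<eta> Y E Z i p r s g by fact
  obtain \<sigma> where \<sigma> [simp]: "is_complex B X" "\<And>n. \<sigma> n \<in> Arr B"
    "\<And>n. Dom B (\<sigma> n) = on_obj T (trm X (n + 1))" "\<And>n. Cod B (\<sigma> n) = trm X n"
    and \<sigma>_dif: "\<And>n. dif X n \<cdot> \<sigma> n \<boxplus> \<sigma> (n + 1) \<cdot> on_arr T (dif X (n + 1)) = \<eta> (trm X (n + 1))"
    using assms(2) by (rule eta_contractibleE) blast
  have dif_\<sigma>: "dif X n \<cdot> \<sigma> n = \<eta> (trm X (n + 1)) \<boxplus> Neg B (\<sigma> (n + 1) \<cdot> on_arr T (dif X (n + 1)))" for n
    by (rule add_eq_left[OF \<sigma>_dif]) auto
  note [simp] = dif_\<sigma>[THEN comp_rewrite]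
  define v where "v = \<lparr>src = E, tgt = X, cmp = (\<lambda>n. cmp w n \<cdot> r n \<boxplus>
    \<sigma> n \<cdot> (on_arr T (cmp w (n + 1)) \<cdot> (g n \<cdot> cmp p n)))\<rparr>"
  have "is_chain_map B v"
    by (rule chain_mapI) (auto simp: v_def add_ac)
  moreover have "v \<cdot>\<^bsub>Cpx B\<^esub> i = w"
    by (rule chain_map_eqI) (auto simp: v_def)
  ultimately show ?thesis by (intro exI[where x = v]) (auto simp: v_def)
qed

text \<open>
  The map \<open>s w\<close> lifts \<open>w\<close> in each degree and differs from a chain map by \<open>i \<eta> g w\<close>.  With \<open>h = (g w)(-1)\<close>
  naturality gives \<open>\<eta> g w = h \<eta>\<close>, and \<open>\<eta>\<close> at \<open>X(-1)\<close> is null-homotopic by the homotopy \<open>\<sigma>(-1)\<close>; so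
  \<open>i h \<sigma>(-1)\<close> is the correction.
\<close>
lemma eta_contractible_lifts:
  assumes "eta_split B T U \<eta> Y E Z i p r s g" and "eta_contractible X"
    and w [simp]: "is_chain_map B w" "src w = X" "tgt w = Z"
  shows "\<exists>v. is_chain_map B v \<and> src v = X \<and> tgt v = E \<and> p \<cdot>\<^bsub>Cpx B\<^esub> v = w"
proof -
  interpret S: eta_split B T U \<eta> Y E Z i p r s g by fact
  obtain \<sigma> where \<sigma> [simp]: "is_complex B X" "\<And>n. \<sigma> n \<in> Arr B"
    "\<And>n. Dom B (\<sigma> n) = on_obj T (trm X (n + 1))" "\<And>n. Cod B (\<sigma> n) = trm X n"
    and \<sigma>_dif: "\<And>n. dif X n \<cdot> \<sigma> n \<boxplus> \<sigma> (n + 1) \<cdot> on_arr T (dif X (n + 1)) = \<eta> (trm X (n + 1))"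
    using assms(2) by (rule eta_contractibleE) blast
  have "on_arr U (dif X n \<cdot> \<sigma> n \<boxplus> \<sigma> (n + 1) \<cdot> on_arr T (dif X (n + 1))) = on_arr U (\<eta> (trm X (n + 1)))" for n
    by (simp only: \<sigma>_dif)
  then have U\<sigma>: "on_arr U (dif X n) \<cdot> on_arr U (\<sigma> n) \<boxplus> on_arr U (\<sigma> (n + 1)) \<cdot> dif X (n + 1) =
      \<eta> (on_obj U (trm X (n + 1)))" for n
    by simp
  have U\<sigma>_dif: "on_arr U (\<sigma> (n + 1)) \<cdot> dif X (n + 1) = \<eta> (on_obj U (trm X (n + 1))) \<boxplus>
      Neg B (on_arr U (dif X n) \<cdot> on_arr U (\<sigma> n))" for n
    by (rule add_eq_right[OF U\<sigma>]) auto
  define h where "h n = on_arr U (g n \<cdot> cmp w n)" for n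
  have h [simp]: "h n \<in> Arr B" "Dom B (h n) = on_obj U (trm X n)" "Cod B (h n) = trm Y (n + 1)" for n
    by (simp_all add: h_def)
  have h_\<eta>: "h n \<cdot> \<eta> (on_obj U (trm X n)) = \<eta> (trm Y (n + 1)) \<cdot> (g n \<cdot> cmp w n)" for n
    using \<eta>_nat[of "h n" "trm Y (n + 1)"] by (simp add: h_def)
  have h_dif: "h (n + 1) \<cdot> on_arr U (dif X n) = Neg B (dif Y (n + 1) \<cdot> h n)" for n
  proof -
    have "on_arr U (g (n + 1) \<cdot> (cmp w (n + 1) \<cdot> dif X n)) =
        on_arr U (Neg B (on_arr T (dif Y (n + 1)) \<cdot> (g n \<cdot> cmp w n)))"
      by (rule arg_cong[OF S.g_chain]) auto
    then show ?thesis by (simp add: h_def del: S.g_chain)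
  qed
  note [simp] = h_dif[THEN comp_rewrite]
  \<comment> \<open>The homotopy is indexed by its target, so the composite ending in degree \<open>n\<close> uses index \<open>n - 1\<close>.\<close>
  define t where "t n = h (n - 1) \<cdot> on_arr U (\<sigma> (n - 1))" for n
  have t [simp]: "t n \<in> Arr B" "Dom B (t n) = trm X n" "Cod B (t n) = trm Y n" for n
    by (simp_all add: t_def)
  have t_Suc: "t (n + 1) = h n \<cdot> on_arr U (\<sigma> n)" for n
    by (simp add: t_def)
  have "t (n + 2) \<cdot> dif X (n + 1) = \<eta> (trm Y (n + 2)) \<cdot> (g (n + 1) \<cdot> cmp w (n + 1)) \<boxplus> dif Y (n + 1) \<cdot> t (n + 1)" for n
    using h_\<eta>[of "n + 1"] by (simp add: t_Suc t_Suc[of "n + 1", simplified] U\<sigma>_dif)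
  moreover have "(n::int) - 1 + 2 = n + 1" "n - 1 + 1 = n" for n by simp_all
  ultimately
  have t_dif: "t (n + 1) \<cdot> dif X n = \<eta> (trm Y (n + 1)) \<cdot> (g n \<cdot> cmp w n) \<boxplus> dif Y n \<cdot> t n" for n
    by metis
  define v where "v = \<lparr>src = X, tgt = E, cmp = (\<lambda>n. s n \<cdot> cmp w n \<boxplus> cmp i n \<cdot> t n)\<rparr>"
  have "is_chain_map B v"
    by (rule chain_mapI) (auto simp: v_def t_dif add_ac)
  moreover have "p \<cdot>\<^bsub>Cpx B\<^esub> v = w"
    by (rule chain_map_eqI) (auto simp: v_def)
  ultimately show ?thesis by (intro exI[where x = v]) (auto simp: v_def)
qed

text \<open>
  If \<open>q c\<close> is the identity, then \<open>q \<sigma> c(1)\<close> is a homotopy for the retract.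
\<close>
lemma eta_contractible_retract:
  assumes "eta_contractible X" and c: "is_chain_map B c" "src c = A" "tgt c = X"
    and q: "is_chain_map B q" "src q = X" "tgt q = A"
    and qc: "q \<cdot>\<^bsub>Cpx B\<^esub> c = ident (Cpx B) A"
  shows "eta_contractible A"
proof -
  note [simp] = c q
  have [simp]: "is_complex B A" using chain_typed(1)[OF c(1)] by simp
  obtain \<sigma> where \<sigma> [simp]: "is_complex B X" "\<And>n. \<sigma> n \<in> Arr B"
    "\<And>n. Dom B (\<sigma> n) = on_obj T (trm X (n + 1))" "\<And>n. Cod B (\<sigma> n) = trm X n"
    and \<sigma>_dif: "\<And>n. dif X n \<cdot> \<sigma> n \<boxplus> \<sigma> (n + 1) \<cdot> on_arr T (dif X (n + 1)) = \<eta> (trm X (n + 1))"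
    using assms(1) by (rule eta_contractibleE) blast
  have dif_\<sigma>: "dif X n \<cdot> \<sigma> n = \<eta> (trm X (n + 1)) \<boxplus> Neg B (\<sigma> (n + 1) \<cdot> on_arr T (dif X (n + 1)))" for n
    by (rule add_eq_left[OF \<sigma>_dif]) auto
  note [simp] = dif_\<sigma>[THEN comp_rewrite]
  have qc: "cmp q n \<cdot> cmp c n = ident B (trm A n)" for n
    using arg_cong[OF qc, of "\<lambda>f. cmp f n"] by simp
  note [simp] = qc qc[THEN comp_rewrite]
  show ?thesis
    by (rule eta_contractibleI[where \<sigma> = "\<lambda>n. cmp q n \<cdot> (\<sigma> n \<cdot> on_arr T (cmp c (n + 1)))"]) (auto simp: add_ac)
qed

text \<open>
  The extension of \<open>Y(1)[1]\<close> by \<open>Y\<close> with \<open>g\<close> the identity is the cone of \<open>\<eta>\<^sub>Y\<close>.  Since \<open>Z\<^sup>n = Y(1)\<^sup>n\<^sup>+\<^sup>1\<close>, the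
  composite \<open>\<sigma> = s r(1)\<close> has the degrees of a homotopy.  In \<open>d \<sigma> + \<sigma> d\<close> the two terms with the differential of
  \<open>Y(1)\<close> cancel by the sign in the shift, and \<open>i \<eta> r(1) + s \<eta> p(1) = (i r + s p) \<eta>\<close> remains.  The diagonal
  entry at \<open>Y(1)[1]\<close> uses that \<open>\<eta>\<close> at \<open>Y(1)\<close> is \<open>\<eta>\<^sub>Y(1)\<close>.
\<close>
lemma eta_contractible_extension:
  assumes "is_complex B Y"
  shows "\<exists>E i p r s. eta_split B T U \<eta> Y E (cpx_shift B (on_obj (cpx_fctr T) Y)) i p r s
    (\<lambda>n. ident B (on_obj T (trm Y (n + 1)))) \<and> eta_contractible E"
proof -
  note Y [simp] = assms
  obtain E i p r s where "eta_split B T U \<eta> Y E (cpx_shift B (on_obj (cpx_fctr T) Y)) i p r s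
    (\<lambda>n. ident B (on_obj T (trm Y (n + 1))))"
    using eta_extension_exists[of Y "cpx_shift B (on_obj (cpx_fctr T) Y)" "\<lambda>n. ident B (on_obj T (trm Y (n + 1)))"]
    by auto
  then interpret S: eta_split B T U \<eta> Y E "cpx_shift B (on_obj (cpx_fctr T) Y)" i p r s
    "\<lambda>n. ident B (on_obj T (trm Y (n + 1)))" .
  have [simp]: "Dom B (s n) = on_obj T (trm Y (n + 1))" "Cod B (cmp p n) = on_obj T (trm Y (n + 1))" for n
    using S.typed(11)[of n] chain_typed(5)[of p n] by auto
  have "eta_contractible E"
    by (rule eta_contractibleI[where \<sigma> = "\<lambda>n. s n \<cdot> on_arr T (r (n + 1))"])
      (auto simp: S.T_r_dif add_cancel_pair' S.split_left)
  then show ?thesis using S.eta_split_axioms by blast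
qed

lemma eta_contractible_injective:
  assumes "eta_contractible X"
  shows "injective_object (Cpx B) \<E> X"
  unfolding injective_object_def
proof (intro conjI allI impI)
  show "X \<in> Obj (Cpx B)" using assms by (simp add: eta_contractible_def)
  fix i f assume fi: "inflation \<E> i \<and> f \<in> Hom (Cpx B) (Dom (Cpx B) i) X"
  then obtain Y E Z p r s g where S: "eta_split B T U \<eta> Y E Z i p r s g"
    by (auto simp: inflation_iff)
  from eta_contractible_extends[OF S assms, of f] fi eta_split_ends[OF S]
  show "\<exists>g\<in>Hom (Cpx B) (Cod (Cpx B) i) X. g \<cdot>\<^bsub>Cpx B\<^esub> i = f"
    by (auto simp del: Cpx_sel(6))
qed

lemma eta_contractible_projective:
  assumes "eta_contractible X"
  shows "projective_object (Cpx B) \<E> X"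
  unfolding projective_object_def
proof (intro conjI allI impI)
  show "X \<in> Obj (Cpx B)" using assms by (simp add: eta_contractible_def)
  fix p f assume pf: "deflation \<E> p \<and> f \<in> Hom (Cpx B) X (Cod (Cpx B) p)"
  then obtain Y E Z i r s g where S: "eta_split B T U \<eta> Y E Z i p r s g"
    by (auto simp: deflation_iff)
  from eta_contractible_lifts[OF S assms, of f] pf eta_split_ends[OF S]
  show "\<exists>g\<in>Hom (Cpx B) X (Dom (Cpx B) p). p \<cdot>\<^bsub>Cpx B\<^esub> g = f"
    by (auto simp del: Cpx_sel(6))
qed

text \<open>
  The extension above for \<open>Y = A(-1)[-1]\<close> has \<open>Y(1)[1] = A\<close> as its quotient.
\<close>
lemma eta_contractible_cover:
  assumes A: "is_complex B A"
  shows "\<exists>X p. eta_contractible X \<and> p \<in> Hom (Cpx B) X A \<and> deflation \<E> p"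
proof -
  note A [simp]
  define Y where "Y = unshift B (on_obj (cpx_fctr U) A)"
  have Y: "is_complex B Y" by (simp add: Y_def)
  have shift: "cpx_shift B (on_obj (cpx_fctr T) Y) = A"
    by (rule cochain.equality) (auto simp: cpx_shift_def Y_def)
  obtain E i p r s where S: "eta_split B T U \<eta> Y E A i p r s (\<lambda>n. ident B (on_obj T (trm Y (n + 1))))"
    and E: "eta_contractible E"
    using eta_contractible_extension[OF Y] unfolding shift by blast
  interpret S: eta_split B T U \<eta> Y E A i p r s "\<lambda>n. ident B (on_obj T (trm Y (n + 1)))" by (rule S)
  have "deflation \<E> p" unfolding deflation_iff using S by blast
  with E S.p_hom show ?thesis by blast
qed

lemma eta_contractible_envelope:
  assumes A: "is_complex B A"
  shows "\<exists>X i. eta_contractible X \<and> i \<in> Hom (Cpx B) A X \<and> inflation \<E> i"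
proof -
  obtain E i p r s where S: "eta_split B T U \<eta> A E (cpx_shift B (on_obj (cpx_fctr T) A)) i p r s
      (\<lambda>n. ident B (on_obj T (trm A (n + 1))))" and E: "eta_contractible E"
    using eta_contractible_extension[OF A] by blast
  interpret S: eta_split B T U \<eta> A E "cpx_shift B (on_obj (cpx_fctr T) A)" i p r s
    "\<lambda>n. ident B (on_obj T (trm A (n + 1)))" by (rule S)
  have "inflation \<E> i" unfolding inflation_iff using S by blast
  with E S.i_hom show ?thesis by blast
qed

text \<open>
  A projective complex is a retract of its \<open>\<eta>\<close>-contractible cover.
\<close>
lemma projective_iff_eta_contractible:
  "projective_object (Cpx B) \<E> A \<longleftrightarrow> eta_contractible A"
proof
  assume P: "projective_object (Cpx B) \<E> A"
  then have A: "is_complex B A" by (simp add: projective_object_def)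
  then obtain X p where X: "eta_contractible X" and p: "p \<in> Hom (Cpx B) X A" "deflation \<E> p"
    using eta_contractible_cover by blast
  have "ident (Cpx B) A \<in> Hom (Cpx B) A (Cod (Cpx B) p)" using A p(1) by simp
  then obtain c where "c \<in> Hom (Cpx B) A (Dom (Cpx B) p)" "p \<cdot>\<^bsub>Cpx B\<^esub> c = ident (Cpx B) A"
    using P p(2) unfolding projective_object_def by blast
  then show "eta_contractible A"
    using p(1) by (intro eta_contractible_retract[OF X, of c A p]) (auto simp del: Cpx_sel(5,6))
qed (rule eta_contractible_projective)

lemma injective_iff_eta_contractible:
  "injective_object (Cpx B) \<E> A \<longleftrightarrow> eta_contractible A"
proof
  assume I: "injective_object (Cpx B) \<E> A"
  then have A: "is_complex B A" by (simp add: injective_object_def)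
  then obtain X i where X: "eta_contractible X" and i: "i \<in> Hom (Cpx B) A X" "inflation \<E> i"
    using eta_contractible_envelope by blast
  have "ident (Cpx B) A \<in> Hom (Cpx B) (Dom (Cpx B) i) A" using A i(1) by simp
  then obtain q where "q \<in> Hom (Cpx B) (Cod (Cpx B) i) A" "q \<cdot>\<^bsub>Cpx B\<^esub> i = ident (Cpx B) A"
    using I i(2) unfolding injective_object_def by blast
  then show "eta_contractible A"
    using i(1) by (intro eta_contractible_retract[OF X, of i A q]) (auto simp del: Cpx_sel(5,6))
qed (rule eta_contractible_injective)

lemma eta_frobenius_category: "frobenius_category (Cpx B) \<E>"
proof -
  interpret X: exact_category "Cpx B" \<E> by (rule eta_exact_category)
  show ?thesis
  proof
    fix A assume "A \<in> Obj (Cpx B)"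
    then have A: "is_complex B A" by simp
    show "\<exists>P p. projective_object (Cpx B) \<E> P \<and> p \<in> Hom (Cpx B) P A \<and> deflation \<E> p"
      using eta_contractible_cover[OF A] eta_contractible_projective by blast
    show "\<exists>I i. injective_object (Cpx B) \<E> I \<and> i \<in> Hom (Cpx B) A I \<and> inflation \<E> i"
      using eta_contractible_envelope[OF A] eta_contractible_injective by blast
    show "projective_object (Cpx B) \<E> A \<longleftrightarrow> injective_object (Cpx B) \<E> A"
      by (simp only: projective_iff_eta_contractible injective_iff_eta_contractible)
  qed
qed

end

theorem theorem3p7:
  fixes B :: "('o, 'm) cat"
    and T :: "('o, 'm, 'o, 'm) fctr"
    and \<eta> :: "'o \<Rightarrow> 'm"
  assumes "additive_category B"
    and "additive_functor B B T"
    and "category_automorphism B T"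
    and "natural_transformation B B T id_fctr \<eta>"
    and "\<And>X. X \<in> Obj B \<Longrightarrow> \<eta> (on_obj T X) = on_arr T (\<eta> X)"
  shows "frobenius_category (Cpx B) (eta_conflations B T \<eta>)"
proof -
  obtain U where "is_functor B B U"
    "\<forall>A\<in>Obj B. on_obj U (on_obj T A) = A \<and> on_obj T (on_obj U A) = A"
    "\<forall>f\<in>Arr B. on_arr U (on_arr T f) = f \<and> on_arr T (on_arr U f) = f"
    using assms(3) unfolding category_automorphism_def by blast
  then have "eta_setting B T U \<eta>"
    using assms by (intro eta_setting.intro eta_setting_axioms.intro) auto
  then show ?thesis by (rule eta_setting.eta_frobenius_category)
qed

end
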